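(* There is an algorithm which, given two primitive substitutions $\alpha$ and $\beta$ of the same constant length $L>1$ with $X_\alpha$ and $X_\beta$ infinite, decides whether the dynamical systems $(X_\alpha,\sigma)$ and $(X_\beta,\sigma)$ are topologically conjugate.
   Context: An alphabet is a finite set $A$ with at least two elements. A substitution on $A$ is a map $\alpha:A\to A^*$, extended to finite and infinite words by juxtaposition; it has constant length $L$ if $\alpha(a)\in A^L$ for every $a\in A$. It is primitive if for some $n>0$ and every $a\in A$ the word $\alpha^n(a)$ contains every letter of $A$. The language $\mathcal{L}_\alpha\subseteq A^*$ is the set of all factors (words of consecutive letters) of words $\alpha^n(a)$, $a\in A$, $n\ge 1$. $X_\alpha\subseteq A^{\mathbb{Z}}$ is the set of bi-infinite sequences all of whose finite factors lie in $\mathcal{L}_\alpha$, and $\sigma$ is the left shift. Two systems are topologically conjugate if there is a homeomorphism between them commuting with $\sigma$. *)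

theory Defs
  imports "HOL-Analysis.Analysis" "HOL-Library.Sublist" "HOL-Library.Nat_Bijection"
begin

section \<open>Substitutions and their shift spaces\<close>

definition substitution :: "'a set \<Rightarrow> ('a \<Rightarrow> 'a list) \<Rightarrow> bool" where
  "substitution A \<alpha> \<longleftrightarrow> finite A \<and> card A \<ge> 2 \<and> (\<forall>a\<in>A. \<alpha> a \<in> lists A)"

definition constant_length :: "nat \<Rightarrow> 'a set \<Rightarrow> ('a \<Rightarrow> 'a list) \<Rightarrow> bool" where
  "constant_length L A \<alpha> \<longleftrightarrow> (\<forall>a\<in>A. length (\<alpha> a) = L)"

definition subst_word :: "('a \<Rightarrow> 'a list) \<Rightarrow> 'a list \<Rightarrow> 'a list" where
  "subst_word \<alpha> w = concat (map \<alpha> w)"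

definition primitive_subst :: "'a set \<Rightarrow> ('a \<Rightarrow> 'a list) \<Rightarrow> bool" where
  "primitive_subst A \<alpha> \<longleftrightarrow> (\<exists>n>0. \<forall>a\<in>A. A \<subseteq> set ((subst_word \<alpha> ^^ n) [a]))"

definition subst_language :: "'a set \<Rightarrow> ('a \<Rightarrow> 'a list) \<Rightarrow> 'a list set" where
  "subst_language A \<alpha> = {w. \<exists>a\<in>A. \<exists>n\<ge>1. sublist w ((subst_word \<alpha> ^^ n) [a])}"

definition window :: "(int \<Rightarrow> 'a) \<Rightarrow> int \<Rightarrow> nat \<Rightarrow> 'a list" where
  "window x i n = map (\<lambda>j. x (i + int j)) [0..<n]"

definition subst_space :: "'a set \<Rightarrow> ('a \<Rightarrow> 'a list) \<Rightarrow> (int \<Rightarrow> 'a) set" where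
  "subst_space A \<alpha> = {x \<in> UNIV \<rightarrow> A. \<forall>i n. window x i n \<in> subst_language A \<alpha>}"

definition left_shift :: "(int \<Rightarrow> 'a) \<Rightarrow> (int \<Rightarrow> 'a)" where
  "left_shift x = (\<lambda>i. x (i + 1))"

definition subst_topology :: "'a set \<Rightarrow> ('a \<Rightarrow> 'a list) \<Rightarrow> (int \<Rightarrow> 'a) topology" where
  "subst_topology A \<alpha> =
     subtopology (product_topology (\<lambda>_. discrete_topology A) UNIV) (subst_space A \<alpha>)"

definition topologically_conjugate ::
  "'x topology \<Rightarrow> ('x \<Rightarrow> 'x) \<Rightarrow> 'y topology \<Rightarrow> ('y \<Rightarrow> 'y) \<Rightarrow> bool" where
  "topologically_conjugate X f Y g \<longleftrightarrow>
     (\<exists>h. homeomorphic_map X Y h \<and> (\<forall>x\<in>topspace X. h (f x) = g (h x)))"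

section \<open>Algorithms: partial recursive functions\<close>

text \<open>
  Programs carry no arity. Restricted to argument lists of any fixed length they denote
  exactly the usual partial recursive functions of that arity; \<open>None\<close> stands for
  divergence, and also results from too short an argument list.
\<close>

datatype recf =
    Zero
  | Succ
  | Proj nat
  | Comp recf "recf list"
  | PrimRec recf recf
  | Mu recf

fun run :: "recf \<Rightarrow> nat list \<Rightarrow> nat option" where
  "run Zero xs = Some 0"
| "run Succ xs = (case xs of [] \<Rightarrow> None | x # _ \<Rightarrow> Some (Suc x))"
| "run (Proj i) xs = (if i < length xs then Some (xs ! i) else None)"
| "run (Comp f gs) xs =
     (if \<forall>g\<in>set gs. run g xs \<noteq> None then run f (map (\<lambda>g. the (run g xs)) gs) else None)"
| "run (PrimRec f g) xs =
     (case xs of [] \<Rightarrow> None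
      | n # ys \<Rightarrow> rec_nat (run f ys) (\<lambda>k r. Option.bind r (\<lambda>v. run g (k # v # ys))) n)"
| "run (Mu f) xs =
     (if \<exists>n. run f (n # xs) = Some 0 \<and> (\<forall>m<n. run f (m # xs) \<noteq> None)
      then Some (LEAST n. run f (n # xs) = Some 0) else None)"

text \<open>
  An algorithm receives a substitution as the code of its finite table of pairs
  \<open>(a, \<alpha> a)\<close>; the table also determines the alphabet. Letters are natural numbers.
\<close>

definition subst_code :: "nat set \<Rightarrow> (nat \<Rightarrow> nat list) \<Rightarrow> nat" where
  "subst_code A \<alpha> =
     list_encode (map (\<lambda>a. prod_encode (a, list_encode (\<alpha> a))) (sorted_list_of_set A))"

end

theory Submission
  imports Defs
begin

text \<open>
  Points of \<open>X\<^sub>\<alpha>\<close> desubstitute uniquely: \<open>x = \<sigma> ^ k (\<alpha> (y))\<close> with \<open>0 \<le> k < L\<close> and \<open>y \<in> X\<^sub>\<alpha>\<close>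
  determined by \<open>x\<close>. Hence a conjugacy \<open>F\<close> induces another one, \<open>F'\<close>, by \<open>F \<circ> \<alpha> = \<sigma> ^ k \<circ> \<beta> \<circ> F'\<close>,
  and passing from \<open>F\<close> to \<open>F'\<close> divides the radius of the block map by \<open>L\<close>, up to an additive constant
  governed by a radius \<open>M\<close> within which \<open>\<alpha>\<close> and \<open>\<beta>\<close> can be inverted. If the spaces are conjugate at all,
  then there are conjugacies \<open>F\<^sub>0, F\<^sub>1, \<dots>\<close> of radius at most \<open>2 * M + 6\<close>, each inducing the next, and by
  the pigeonhole principle one of them satisfies \<open>F \<circ> \<alpha> ^ m = \<sigma> ^ K \<circ> \<beta> ^ m \<circ> F\<close> with \<open>m\<close> and \<open>K\<close>
  bounded. Conversely, this identity for a block map \<open>F\<close>, together with conditions on the words of bounded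
  length, forces \<open>F\<close> to be a conjugacy. The algorithm searches for \<open>M\<close> and for a depth at which the words of
  the required lengths are all known, and then tests the finitely many candidates.
\<close>

section \<open>Computable functions on encoded types\<close>

text \<open>Uniqueness of desubstitution is where infiniteness enters. The displacements at which
  two \<open>n\<close>-fold images can coincide form a subgroup of the integers containing
  \<open>L ^ n\<close>; if \<open>L ^ n\<close> were a large multiple of its generator, there would
  be too few words of some length for an infinite space. So the ratio is bounded, becomes constant
  with growing \<open>n\<close>, and has to be 1. The substitutions need not be injective on
  letters: a letter is determined only by the images of its neighbours. This is the origin of
  \<open>M\<close>, which exists by compactness, without a computed bound. It can be searched for
  because a candidate is verified on the words of length \<open>2 * M + 1\<close>, and a list of
  words is certified to be complete by its not growing at the next depth. The constant
  \<open>2 * M + 6\<close> is the fixed point of the radius estimate \<open>M + 3 + r div 2\<close>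
  for one renormalization step. The estimate holds for the inverse map as well, so that injectivity
  of a candidate is also a condition on words of bounded length.\<close>

lemma run_Comp1: "run g xs = Some a \<Longrightarrow> run (Comp f [g]) xs = run f [a]"
  by simp

lemma run_Comp2:
  "run g xs = Some a \<Longrightarrow> run h xs = Some b \<Longrightarrow> run (Comp f [g, h]) xs = run f [a, b]"
  by simp

lemma run_PrimRec:
  assumes "run f ys = Some a" and "\<And>k v. run g (k # v # ys) = Some (h k v)"
  shows "run (PrimRec f g) (n # ys) = Some (rec_nat a h n)"
proof -
  have "rec_nat (run f ys) (\<lambda>k r. Option.bind r (\<lambda>v. run g (k # v # ys))) n = Some (rec_nat a h n)"
    by (induction n) (simp_all add: assms)
  then show ?thesis by simp
qed

lemma run_Mu:
  assumes "\<And>n. run f (n # xs) = Some (h n)" and "\<exists>n. h n = 0"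
  shows "run (Mu f) xs = Some (LEAST n. h n = 0)"
  using assms by simp

declare run.simps(4-6) [simp del]

section \<open>Arithmetic and the Cantor pairing as programs\<close>

definition add_prog :: recf where
  "add_prog = PrimRec (Proj 0) (Comp Succ [Proj 1])"

lemma run_add_prog: "run add_prog [m, n] = Some (m + n)"
proof -
  have "run add_prog [m, n] = Some (rec_nat n (\<lambda>_. Suc) m)"
    unfolding add_prog_def by (rule run_PrimRec) (simp_all add: run_Comp1)
  moreover have "rec_nat n (\<lambda>_. Suc) m = m + n" by (induction m) simp_all
  ultimately show ?thesis by simp
qed

definition pred_prog :: recf where
  "pred_prog = PrimRec Zero (Proj 0)"

lemma run_pred_prog: "run pred_prog [n] = Some (n - 1)"
proof -
  have "run pred_prog [n] = Some (rec_nat 0 (\<lambda>k _. k) n)"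
    unfolding pred_prog_def by (rule run_PrimRec) simp_all
  then show ?thesis by (cases n) simp_all
qed

text \<open>Recursion runs on the first argument, which is therefore the number subtracted.\<close>

definition diff_prog :: recf where
  "diff_prog = PrimRec (Proj 0) (Comp pred_prog [Proj 1])"

lemma run_diff_prog: "run diff_prog [n, m] = Some (m - n)"
proof -
  have "run diff_prog [n, m] = Some (rec_nat m (\<lambda>_ r. r - 1) n)"
    unfolding diff_prog_def by (rule run_PrimRec) (simp_all add: run_Comp1 run_pred_prog)
  moreover have "rec_nat m (\<lambda>_ r. r - 1) n = m - n" by (induction n) simp_all
  ultimately show ?thesis by simp
qed

definition triangle_prog :: recf where
  "triangle_prog = PrimRec Zero (Comp add_prog [Comp Succ [Proj 0], Proj 1])"

lemma run_triangle_prog: "run triangle_prog [n] = Some (triangle n)"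
proof -
  have "run triangle_prog [n] = Some (rec_nat 0 (\<lambda>k r. Suc k + r) n)"
    unfolding triangle_prog_def
  proof (rule run_PrimRec)
    fix k v
    have "run (Comp Succ [Proj 0]) [k, v] = Some (Suc k)" by (simp add: run_Comp1)
    then show "run (Comp add_prog [Comp Succ [Proj 0], Proj 1]) [k, v] = Some (Suc k + v)"
      by (subst run_Comp2) (simp_all only: run_add_prog, simp)
  qed simp
  moreover have "rec_nat 0 (\<lambda>k r. Suc k + r) n = triangle n" by (induction n) simp_all
  ultimately show ?thesis by simp
qed

definition pair_prog :: recf where
  "pair_prog = Comp add_prog [Comp triangle_prog [add_prog], Proj 0]"

lemma run_pair_prog: "run pair_prog [m, n] = Some (prod_encode (m, n))"
proof -
  have "run (Comp triangle_prog [add_prog]) [m, n] = Some (triangle (m + n))"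
    by (subst run_Comp1[OF run_add_prog]) (simp add: run_triangle_prog)
  then show ?thesis
    unfolding pair_prog_def prod_encode_def
    by (subst run_Comp2) (simp_all add: run_add_prog)
qed

text \<open>The pair \<open>(m, n)\<close> is coded by \<open>triangle (m + n) + m\<close>, which is
  at least \<open>triangle (m + n)\<close> and below \<open>triangle (Suc (m + n))\<close>. So
  \<open>m + n\<close> is the least \<open>s\<close> for which the code \<open>z\<close> is below
  \<open>triangle (Suc s)\<close>, that is, for which \<open>Suc z - triangle (Suc s)\<close>
  vanishes.\<close>

definition diag_prog :: recf where
  "diag_prog = Mu (Comp diff_prog [Comp triangle_prog [Comp Succ [Proj 0]], Comp Succ [Proj 1]])"

lemma triangle_mono: "m \<le> n \<Longrightarrow> triangle m \<le> triangle n"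
  by (rule lift_Suc_mono_le[of triangle]) simp_all

lemma run_diag_prog: "run diag_prog [prod_encode (m, n)] = Some (m + n)"
proof -
  let ?z = "prod_encode (m, n)"
  have 1: "run (Comp diff_prog [Comp triangle_prog [Comp Succ [Proj 0]], Comp Succ [Proj 1]]) [s, ?z]
      = Some (Suc ?z - triangle (Suc s))" for s
  proof -
    have "run (Comp Succ [Proj 0]) [s, ?z] = Some (Suc s)"
      by (simp add: run_Comp1)
    then have "run (Comp triangle_prog [Comp Succ [Proj 0]]) [s, ?z] = Some (triangle (Suc s))"
      by (subst run_Comp1) (simp_all only: run_triangle_prog)
    moreover have "run (Comp Succ [Proj 1]) [s, ?z] = Some (Suc ?z)"
      by (simp add: run_Comp1)
    ultimately show ?thesis by (subst run_Comp2) (simp_all only: run_diff_prog)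
  qed
  have 2: "Suc ?z - triangle (Suc (m + n)) = 0"
    by (simp add: prod_encode_def)
  have "run diag_prog [?z] = Some (LEAST s. Suc ?z - triangle (Suc s) = 0)"
    unfolding diag_prog_def by (rule run_Mu[OF 1]) (use 2 in blast)
  also have "(LEAST s. Suc ?z - triangle (Suc s) = 0) = m + n"
  proof (rule Least_equality)
    show "Suc ?z - triangle (Suc (m + n)) = 0" by (rule 2)
    fix s assume s: "Suc ?z - triangle (Suc s) = 0"
    show "m + n \<le> s"
    proof (rule ccontr)
      assume "\<not> m + n \<le> s"
      then have "triangle (Suc s) \<le> triangle (m + n)" by (intro triangle_mono) simp
      with s show False by (simp add: prod_encode_def)
    qed
  qed
  finally show ?thesis .
qed

definition fst_prog :: recf where
  "fst_prog = Comp diff_prog [Comp triangle_prog [diag_prog], Proj 0]"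

lemma run_fst_prog: "run fst_prog [prod_encode (m, n)] = Some m"
proof -
  have "run (Comp triangle_prog [diag_prog]) [prod_encode (m, n)] = Some (triangle (m + n))"
    by (subst run_Comp1[OF run_diag_prog]) (simp add: run_triangle_prog)
  then show ?thesis
    unfolding fst_prog_def
    by (subst run_Comp2) (auto simp: run_diff_prog, simp add: prod_encode_def)
qed

definition snd_prog :: recf where
  "snd_prog = Comp diff_prog [fst_prog, diag_prog]"

lemma run_snd_prog: "run snd_prog [prod_encode (m, n)] = Some n"
  unfolding snd_prog_def
  by (subst run_Comp2[OF run_fst_prog run_diag_prog]) (simp add: run_diff_prog)

section \<open>Coded types and closure properties of computable functions\<close>

class coded =
  fixes code :: "'a \<Rightarrow> nat"
  assumes inj_code: "inj code"
begin

lemma code_eq_iff: "code x = code y \<longleftrightarrow> x = y"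
  using inj_code by (simp add: inj_eq)

end

instantiation nat :: coded
begin
definition code_nat :: "nat \<Rightarrow> nat" where "code_nat n = n"
instance by standard (simp add: code_nat_def inj_def)
end

instantiation bool :: coded
begin
definition code_bool :: "bool \<Rightarrow> nat" where "code_bool b = (if b then 1 else 0)"
instance by standard (simp add: code_bool_def inj_def)
end

instantiation prod :: (coded, coded) coded
begin
definition code_prod :: "'a \<times> 'b \<Rightarrow> nat" where
  "code_prod p = prod_encode (code (fst p), code (snd p))"
instance
  by standard (auto simp: code_prod_def inj_def prod_encode_eq code_eq_iff)
end

instantiation list :: (coded) coded
begin
definition code_list :: "'a list \<Rightarrow> nat" where
  "code_list xs = list_encode (map code xs)"
instance
  by standard (auto simp: code_list_def list_encode_eq inj_map_eq_map[OF inj_code] intro: injI)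
end

text \<open>A program is held to its specification only on codes, which need not exhaust the natural
  numbers (as for \<open>bool\<close>).\<close>

definition computable :: "('a::coded \<Rightarrow> 'b::coded) \<Rightarrow> bool" where
  "computable f \<longleftrightarrow> (\<exists>p. \<forall>x. run p [code x] = Some (code (f x)))"

named_theorems computable_intros

lemma computable_id [computable_intros]: "computable (\<lambda>x. x)"
  unfolding computable_def by (rule exI[of _ "Proj 0"]) simp

lemma computable_comp:
  assumes "computable g" and "computable f"
  shows "computable (\<lambda>x. g (f x))"
proof -
  obtain p q where "\<And>x. run p [code x] = Some (code (g x))"
    and "\<And>x. run q [code x] = Some (code (f x))"
    using assms unfolding computable_def by blast
  then have "\<And>x. run (Comp p [q]) [code x] = Some (code (g (f x)))"
    by (simp add: run_Comp1)
  then show ?thesis unfolding computable_def by blast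
qed

lemma computable_Pair [computable_intros]:
  assumes "computable f" and "computable g"
  shows "computable (\<lambda>x. (f x, g x))"
proof -
  obtain p q where "\<And>x. run p [code x] = Some (code (f x))"
    and "\<And>x. run q [code x] = Some (code (g x))"
    using assms unfolding computable_def by blast
  then have "\<And>x. run (Comp pair_prog [p, q]) [code x] = Some (code (f x, g x))"
    by (simp add: run_Comp2 run_pair_prog code_prod_def)
  then show ?thesis unfolding computable_def by blast
qed

lemma computable_fst [computable_intros]: "computable f \<Longrightarrow> computable (\<lambda>x. fst (f x))"
  by (rule computable_comp[of fst])
    (auto simp: computable_def code_prod_def intro!: exI[of _ fst_prog] run_fst_prog)

lemma computable_snd [computable_intros]: "computable f \<Longrightarrow> computable (\<lambda>x. snd (f x))"
  by (rule computable_comp[of snd])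
    (auto simp: computable_def code_prod_def intro!: exI[of _ snd_prog] run_snd_prog)

lemma computable_const [computable_intros]: "computable (\<lambda>_. c)"
proof -
  have "\<exists>p. \<forall>x. run p [x] = Some n" for n
  proof (induction n)
    case 0
    show ?case by (rule exI[of _ Zero]) simp
  next
    case (Suc n)
    then obtain p where "\<forall>x. run p [x] = Some n" ..
    then have "\<forall>x. run (Comp Succ [p]) [x] = Some (Suc n)" by (simp add: run_Comp1)
    then show ?case by blast
  qed
  then show ?thesis unfolding computable_def by blast
qed

lemma computable_Suc [computable_intros]: "computable f \<Longrightarrow> computable (\<lambda>x. Suc (f x))"
  by (rule computable_comp[of Suc]) (auto simp: computable_def code_nat_def intro!: exI[of _ Succ])

lemma computable_rec_nat [computable_intros]:
  fixes a :: "'a::coded \<Rightarrow> 'b::coded"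
  assumes "computable a" and g: "computable (\<lambda>p. g (fst p) (fst (snd p)) (snd (snd p)))"
    and "computable n"
  shows "computable (\<lambda>x. rec_nat (a x) (g x) (n x))"
proof -
  obtain p q r where p: "\<And>x. run p [code x] = Some (code (a x))"
    and q: "\<And>x. run q [code x] = Some (code (g (fst x) (fst (snd x)) (snd (snd x))))"
    and r: "\<And>x. run r [code x] = Some (code (n x))"
    using assms unfolding computable_def by blast
  \<comment> \<open>\<open>PrimRec\<close> hands over the counter, the previous value and the
    parameter as three arguments; \<open>q\<close> expects one code of the triple in the order
    parameter, counter, value.\<close>
  let ?s = "Comp q [Comp pair_prog [Proj 2, Comp pair_prog [Proj 0, Proj 1]]]"
  have s: "run ?s [k, code v, code x] = Some (code (g x k v))" for k v x
  proof -
    have "run (Comp pair_prog [Proj 0, Proj 1]) [k, code v, code x] = Some (prod_encode (k, code v))"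
      by (simp add: run_Comp2 run_pair_prog)
    then have "run (Comp pair_prog [Proj 2, Comp pair_prog [Proj 0, Proj 1]]) [k, code v, code x]
        = Some (code (x, k, v))"
      by (subst run_Comp2) (auto simp: run_pair_prog code_prod_def code_nat_def)
    then show ?thesis by (simp add: run_Comp1 q)
  qed
  have "run (PrimRec p ?s) [m, code x] = Some (code (rec_nat (a x) (g x) m))" for m x
  proof -
    have "rec_nat (run p [code x])
        (\<lambda>k r. Option.bind r (\<lambda>v. run ?s [k, v, code x])) m = Some (code (rec_nat (a x) (g x) m))"
      by (induction m) (simp_all only: old.nat.simps p s Option.bind.bind_lunit)
    then show ?thesis by (simp add: run.simps)
  qed
  then have "run (Comp (PrimRec p ?s) [r, Proj 0]) [code x] = Some (code (rec_nat (a x) (g x) (n x)))" for x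
    by (subst run_Comp2[OF r]) (simp_all add: code_nat_def)
  then show ?thesis unfolding computable_def by blast
qed

text \<open>A recursion of \<open>code (b x)\<close> steps: no step leaves \<open>g x\<close>, one
  step replaces it by \<open>f x\<close>.\<close>

lemma computable_If [computable_intros]:
  assumes "computable b" and "computable f" and "computable g"
  shows "computable (\<lambda>x. if b x then f x else g x)"
proof -
  have "computable (\<lambda>x. code (b x))"
    using assms(1) by (simp add: computable_def code_nat_def)
  moreover have "computable (\<lambda>p. f (fst p) :: 'b)"
    using assms(2) by (rule computable_comp) (intro computable_intros)
  ultimately have "computable (\<lambda>x. rec_nat (g x) (\<lambda>_ _. f x) (code (b x)))"
    using assms(3) by (intro computable_rec_nat)
  then show ?thesis
    by (rule back_subst[of computable]) (auto simp: code_bool_def fun_eq_iff)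
qed

lemma computable_add [computable_intros]:
  assumes "computable f" and "computable g"
  shows "computable (\<lambda>x. f x + g x :: nat)"
proof -
  have "computable (\<lambda>p :: nat \<times> nat. fst p + snd p)"
    unfolding computable_def
  proof (intro exI allI)
    fix x :: "nat \<times> nat"
    show "run (Comp add_prog [fst_prog, snd_prog]) [code x] = Some (code (fst x + snd x))"
      unfolding code_prod_def run_Comp2[OF run_fst_prog run_snd_prog]
      by (simp add: run_add_prog code_nat_def)
  qed
  from computable_comp[OF this computable_Pair[OF assms]] show ?thesis by simp
qed

lemma computable_diff [computable_intros]:
  assumes "computable f" and "computable g"
  shows "computable (\<lambda>x. f x - g x :: nat)"
proof -
  have "computable (\<lambda>p :: nat \<times> nat. snd p - fst p)"
    unfolding computable_def
  proof (intro exI allI)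
    fix x :: "nat \<times> nat"
    show "run (Comp diff_prog [fst_prog, snd_prog]) [code x] = Some (code (snd x - fst x))"
      unfolding code_prod_def run_Comp2[OF run_fst_prog run_snd_prog]
      by (simp add: run_diff_prog code_nat_def)
  qed
  from computable_comp[OF this computable_Pair[OF assms(2,1)]] show ?thesis by simp
qed

lemma computable_mult [computable_intros]:
  assumes [computable_intros]: "computable f" "computable g"
  shows "computable (\<lambda>x. f x * g x :: nat)"
proof -
  have "computable (\<lambda>x. rec_nat 0 (\<lambda>_ r. r + g x) (f x))"
    by (intro computable_intros computable_comp[OF assms(2)])
  moreover have "rec_nat 0 (\<lambda>_ r. r + b) a = a * b" for a b :: nat
    by (induction a) simp_all
  ultimately show ?thesis by simp
qed

lemma computable_power [computable_intros]:
  assumes [computable_intros]: "computable f" "computable g"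
  shows "computable (\<lambda>x. f x ^ g x :: nat)"
proof -
  have "computable (\<lambda>x. rec_nat 1 (\<lambda>_ r. f x * r) (g x))"
    by (intro computable_intros computable_comp[OF assms(1)])
  moreover have "rec_nat 1 (\<lambda>_ r. a * r) b = a ^ b" for a b :: nat
    by (induction b) simp_all
  ultimately show ?thesis by simp
qed

lemma computable_eq [computable_intros]:
  assumes "computable f" and "computable g"
  shows "computable (\<lambda>x. f x = g x)"
proof -
  have "computable (\<lambda>x. code (f x))" "computable (\<lambda>x. code (g x))"
    using assms by (simp_all add: computable_def code_nat_def)
  then have "computable (\<lambda>x. 1 - ((code (f x) - code (g x)) + (code (g x) - code (f x))))"
    by (intro computable_intros)
  moreover have "1 - ((code (f x) - code (g x)) + (code (g x) - code (f x))) = code (f x = g x)" for x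
    using code_eq_iff[of "f x" "g x"] by (auto simp: code_bool_def)
  ultimately show ?thesis by (simp add: computable_def code_nat_def)
qed

lemma computable_le [computable_intros]:
  assumes [computable_intros]: "computable f" "computable g"
  shows "computable (\<lambda>x. f x \<le> (g x :: nat))"
proof -
  have "computable (\<lambda>x. f x - g x = 0)" by (intro computable_intros)
  then show ?thesis by simp
qed

lemma computable_less [computable_intros]:
  assumes [computable_intros]: "computable f" "computable g"
  shows "computable (\<lambda>x. f x < (g x :: nat))"
proof -
  have "computable (\<lambda>x. Suc (f x) \<le> g x)" by (intro computable_intros)
  then show ?thesis by (simp add: Suc_le_eq)
qed

lemma computable_conj [computable_intros]:
  assumes [computable_intros]: "computable f" "computable g"
  shows "computable (\<lambda>x. f x \<and> g x)"
proof -
  have "computable (\<lambda>x. if f x then g x else False)" by (intro computable_intros)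
  then show ?thesis by (rule back_subst[of computable]) auto
qed

lemma computable_imp [computable_intros]:
  assumes [computable_intros]: "computable f" "computable g"
  shows "computable (\<lambda>x. f x \<longrightarrow> g x)"
proof -
  have "computable (\<lambda>x. if f x then g x else True)" by (intro computable_intros)
  then show ?thesis by (rule back_subst[of computable]) auto
qed

lemma computable_disj [computable_intros]:
  assumes [computable_intros]: "computable f" "computable g"
  shows "computable (\<lambda>x. f x \<or> g x)"
proof -
  have "computable (\<lambda>x. if f x then True else g x)" by (intro computable_intros)
  then show ?thesis by (rule back_subst[of computable]) auto
qed

section \<open>List operations\<close>

lemma computable_Cons [computable_intros]:
  assumes "computable f" and "computable g"
  shows "computable (\<lambda>x. f x # g x)"
proof -
  have "computable (\<lambda>x. Suc (code (f x, g x)))"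
  proof -
    have "computable (\<lambda>x. code (f x, g x))"
      using computable_Pair[OF assms] by (simp add: computable_def code_nat_def)
    then show ?thesis by (rule computable_Suc)
  qed
  then show ?thesis by (simp add: computable_def code_nat_def code_list_def code_prod_def)
qed

lemma computable_of_code:
  assumes "computable (\<lambda>x. code (f x))"
  shows "computable f"
  using assms by (simp add: computable_def code_nat_def)

text \<open>\<open>list_encode\<close> makes the code of \<open>y # ys\<close> the successor of the
  code of \<open>(y, ys)\<close>, so the predecessor splits a nonempty list. The value
  \<open>d\<close> only fills the empty case.\<close>

lemma computable_uncons:
  fixes d :: "'a::coded"
  shows "computable (\<lambda>xs. case xs of [] \<Rightarrow> (d, []) | y # ys \<Rightarrow> (y, ys))"
proof (rule computable_of_code)
  have "computable (\<lambda>xs :: 'a list. code xs)"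
    by (auto simp: computable_def code_nat_def intro!: exI[of _ "Proj 0"])
  then have "computable (\<lambda>xs :: 'a list. if xs = [] then code (d, [] :: 'a list) else code xs - 1)"
    by (intro computable_intros)
  moreover have "(if xs = [] then code (d, [] :: 'a list) else code xs - 1)
      = code (case xs of [] \<Rightarrow> (d, []) | y # ys \<Rightarrow> (y, ys))" for xs :: "'a list"
    by (cases xs) (simp_all add: code_list_def code_prod_def)
  ultimately show "computable (\<lambda>xs :: 'a list. code (case xs of [] \<Rightarrow> (d, []) | y # ys \<Rightarrow> (y, ys)))"
    by simp
qed

lemma computable_tl [computable_intros]:
  fixes f :: "'a::coded \<Rightarrow> 'b::coded list"
  assumes "computable f"
  shows "computable (\<lambda>x. tl (f x))"
proof -
  have "computable (\<lambda>xs :: 'b list. snd (case xs of [] \<Rightarrow> (undefined, []) | y # ys \<Rightarrow> (y, ys)))"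
    by (intro computable_intros computable_uncons)
  also have "(\<lambda>xs :: 'b list. snd (case xs of [] \<Rightarrow> (undefined, []) | y # ys \<Rightarrow> (y, ys))) = tl"
    by (auto simp: fun_eq_iff split: list.split)
  finally show ?thesis using assms by (rule computable_comp)
qed

lemma computable_hd:
  fixes f :: "'a::coded \<Rightarrow> 'b::coded list"
  assumes "computable f"
  shows "computable (\<lambda>x. hd (f x))"
proof -
  \<comment> \<open>The default \<open>hd []\<close> makes this expression equal to
    \<open>hd\<close> on the empty list too.\<close>
  have "computable (\<lambda>xs :: 'b list. fst (case xs of [] \<Rightarrow> (hd [], []) | y # ys \<Rightarrow> (y, ys)))"
    by (intro computable_intros computable_uncons)
  also have "(\<lambda>xs :: 'b list. fst (case xs of [] \<Rightarrow> (hd [], []) | y # ys \<Rightarrow> (y, ys))) = hd"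
    by (auto simp: fun_eq_iff split: list.split)
  finally show ?thesis using assms by (rule computable_comp)
qed

lemma length_le_code: "length xs \<le> code xs"
proof -
  have "length ns \<le> list_encode ns" for ns
  proof (induction ns)
    case (Cons n ns)
    have "list_encode ns \<le> prod_encode (n, list_encode ns)" by (rule le_prod_encode_2)
    with Cons show ?case by simp
  qed simp
  from this[of "map code xs"] show ?thesis by (simp add: code_list_def)
qed

text \<open>
  The code of a list bounds its length, so iterating one step of \<open>fold\<close> that many times
  exhausts the list; superfluous steps do nothing.
\<close>

lemma computable_fold [computable_intros]:
  fixes l :: "'a::coded \<Rightarrow> 'b::coded list" and s :: "'a \<Rightarrow> 'c::coded"
  assumes g: "computable (\<lambda>p. g (fst p) (fst (snd p)) (snd (snd p)))"
    and l [computable_intros]: "computable l" and s [computable_intros]: "computable s"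
  shows "computable (\<lambda>x. fold (g x) (l x) (s x))"
proof -
  define step where "step = (\<lambda>x (st :: 'b list \<times> 'c).
    if fst st = [] then st else (tl (fst st), g x (hd (fst st)) (snd st)))"
  have iter: "rec_nat (xs, a) (\<lambda>_. step x) n = ([], fold (g x) xs a)" if "length xs \<le> n" for x xs a n
  proof -
    have shift: "rec_nat st (\<lambda>_. step x) (Suc n) = rec_nat (step x st) (\<lambda>_. step x) n" for st n
      by (induction n) simp_all
    show ?thesis using that
    proof (induction n arbitrary: xs a)
      case (Suc n)
      then show ?case
        by (cases xs) (simp_all only: shift, simp_all add: step_def)
    qed simp
  qed
  have "computable (\<lambda>p :: ('a \<times> nat \<times> 'b list \<times> 'c).
      g (fst p) (hd (fst (snd (snd p)))) (snd (snd (snd p))))"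
    by (rule computable_comp[OF g, of "\<lambda>p. (fst p, hd (fst (snd (snd p))), snd (snd (snd p)))", simplified])
      (intro computable_intros computable_hd)
  then have "computable (\<lambda>p :: ('a \<times> nat \<times> 'b list \<times> 'c). step (fst p) (snd (snd p)))"
    unfolding step_def by (intro computable_intros)
  moreover have "computable (\<lambda>x. code (l x))"
    using l by (simp add: computable_def code_nat_def)
  ultimately have "computable (\<lambda>x. snd (rec_nat (l x, s x) (\<lambda>_. step x) (code (l x))))"
    by (intro computable_snd computable_rec_nat computable_Pair l s)
  then show ?thesis by (simp add: iter[OF length_le_code])
qed

lemma computable_rev [computable_intros]:
  assumes [computable_intros]: "computable l"
  shows "computable (\<lambda>x. rev (l x))"
  unfolding rev_conv_fold by (intro computable_intros)

lemma computable_foldr: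
  fixes l :: "'a::coded \<Rightarrow> 'b::coded list" and s :: "'a \<Rightarrow> 'c::coded"
  assumes [computable_intros]: "computable (\<lambda>p. g (fst p) (fst (snd p)) (snd (snd p)))" "computable l" "computable s"
  shows "computable (\<lambda>x. foldr (g x) (l x) (s x))"
  unfolding foldr_conv_fold by (intro computable_intros)

lemma computable_append [computable_intros]:
  assumes [computable_intros]: "computable f" "computable g"
  shows "computable (\<lambda>x. f x @ g x)"
proof -
  have "computable (\<lambda>x. foldr (\<lambda>y r. y # r) (f x) (g x))"
    by (intro computable_intros computable_foldr)
  moreover have "foldr (\<lambda>y r. y # r) xs ys = xs @ ys" for xs ys :: "'b list"
    by (induction xs) simp_all
  ultimately show ?thesis by simp
qed

lemma computable_map [computable_intros]:
  fixes g :: "'a::coded \<Rightarrow> 'b::coded \<Rightarrow> 'c::coded"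
  assumes [computable_intros]: "computable (\<lambda>p. g (fst p) (snd p))" "computable l"
  shows "computable (\<lambda>x. map (g x) (l x))"
proof -
  have "computable (\<lambda>p. g (fst p) (fst (snd p)))"
    by (rule computable_comp[OF assms(1), of "\<lambda>p. (fst p, fst (snd p))", simplified])
      (intro computable_intros)
  then have "computable (\<lambda>x. foldr (\<lambda>y r. g x y # r) (l x) [])"
    by (intro computable_foldr computable_intros)
  moreover have "foldr (\<lambda>y r. g x y # r) xs [] = map (g x) xs" for x xs
    by (induction xs) simp_all
  ultimately show ?thesis by simp
qed

lemma computable_concat [computable_intros]:
  assumes [computable_intros]: "computable l"
  shows "computable (\<lambda>x. concat (l x))"
  unfolding concat_conv_foldr by (intro computable_foldr computable_intros)

lemma computable_length [computable_intros]:
  fixes l :: "'a::coded \<Rightarrow> 'b::coded list"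
  assumes [computable_intros]: "computable l"
  shows "computable (\<lambda>x. length (l x))"
proof -
  have "computable (\<lambda>x. foldr (\<lambda>_. Suc) (l x) 0)"
    by (intro computable_foldr computable_intros)
  moreover have "foldr (\<lambda>_. Suc) xs 0 = length xs" for xs :: "'b list"
    by (induction xs) simp_all
  ultimately show ?thesis by simp
qed

lemma computable_Ball [computable_intros]:
  fixes l :: "'a::coded \<Rightarrow> 'b::coded list"
  assumes [computable_intros]: "computable (\<lambda>p. P (fst p) (snd p))" "computable l"
  shows "computable (\<lambda>x. \<forall>y\<in>set (l x). P x y)"
proof -
  have "computable (\<lambda>x. foldr (\<lambda>b r. b \<and> r) (map (P x) (l x)) True)"
    by (intro computable_foldr computable_intros)
  moreover have "foldr (\<lambda>b r. b \<and> r) (map Q xs) True = (\<forall>y\<in>set xs. Q y)" for Q and xs :: "'b list"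
    by (induction xs) simp_all
  ultimately show ?thesis by simp
qed

lemma computable_Bex [computable_intros]:
  fixes l :: "'a::coded \<Rightarrow> 'b::coded list"
  assumes [computable_intros]: "computable (\<lambda>p. P (fst p) (snd p))" "computable l"
  shows "computable (\<lambda>x. \<exists>y\<in>set (l x). P x y)"
proof -
  have "computable (\<lambda>x. foldr (\<lambda>b r. b \<or> r) (map (P x) (l x)) False)"
    by (intro computable_foldr computable_intros)
  moreover have "foldr (\<lambda>b r. b \<or> r) (map Q xs) False = (\<exists>y\<in>set xs. Q y)" for Q and xs :: "'b list"
    by (induction xs) simp_all
  ultimately show ?thesis by simp
qed

lemma computable_member [computable_intros]:
  fixes l :: "'a::coded \<Rightarrow> 'b::coded list"
  assumes f: "computable f" and l: "computable l"
  shows "computable (\<lambda>x. f x \<in> set (l x))"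
proof -
  have "computable (\<lambda>x. \<exists>y\<in>set (l x). y = f x)"
    by (intro computable_intros l computable_comp[OF f])
  then show ?thesis by simp
qed

lemma computable_upt [computable_intros]:
  assumes "computable f" and "computable g"
  shows "computable (\<lambda>x. [f x..<g x])"
proof -
  have 1: "rec_nat [] (\<lambda>k r. if a \<le> k then r @ [k] else r) b = [a..<b]" for a b
    by (induction b) auto
  have "computable (\<lambda>p. rec_nat [] (\<lambda>k r. if fst p \<le> k then r @ [k] else r) (snd p))"
    by (intro computable_intros)
  from computable_comp[OF this computable_Pair[OF assms]] show ?thesis
    by (simp add: 1)
qed

lemma computable_drop [computable_intros]:
  fixes l :: "'a::coded \<Rightarrow> 'b::coded list"
  assumes [computable_intros]: "computable n" "computable l"
  shows "computable (\<lambda>x. drop (n x) (l x))"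
proof -
  have "computable (\<lambda>x. rec_nat (l x) (\<lambda>_. tl) (n x))"
    by (intro computable_intros)
  moreover have "rec_nat xs (\<lambda>_. tl) k = drop k xs" for xs :: "'b list" and k
    by (induction k) (simp_all add: drop_Suc tl_drop)
  ultimately show ?thesis by simp
qed

lemma computable_take [computable_intros]:
  fixes l :: "'a::coded \<Rightarrow> 'b::coded list"
  assumes "computable n" and "computable l"
  shows "computable (\<lambda>x. take (n x) (l x))"
proof -
  have 1: "fold (\<lambda>y r. if length r < k then r @ [y] else r) xs [] = take k xs" for xs :: "'b list" and k
    by (induction xs rule: rev_induct) auto
  have "computable (\<lambda>p :: nat \<times> 'b list. fold (\<lambda>y r. if length r < fst p then r @ [y] else r) (snd p) [])"
    by (intro computable_intros)
  from computable_comp[OF this computable_Pair[OF assms]] show ?thesis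
    by (simp add: 1)
qed

lemma computable_n_lists [computable_intros]:
  fixes l :: "'a::coded \<Rightarrow> 'b::coded list"
  assumes "computable n" and "computable l"
  shows "computable (\<lambda>x. List.n_lists (n x) (l x))"
proof -
  have 1: "rec_nat [[]] (\<lambda>_ r. concat (map (\<lambda>ys. map (\<lambda>y. y # ys) xs) r)) k = List.n_lists k xs"
    for xs :: "'b list" and k
    by (induction k) simp_all
  have "computable (\<lambda>p :: nat \<times> 'b list.
      rec_nat [[]] (\<lambda>_ r. concat (map (\<lambda>ys. map (\<lambda>y. y # ys) (snd p)) r)) (fst p))"
    by (intro computable_intros)
  from computable_comp[OF this computable_Pair[OF assms]] show ?thesis
    by (simp add: 1)
qed

lemma computable_zip [computable_intros]:
  fixes f :: "'a::coded \<Rightarrow> 'b::coded list" and g :: "'a \<Rightarrow> 'c::coded list"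
  assumes "computable f" and "computable g"
  shows "computable (\<lambda>x. zip (f x) (g x))"
proof -
  have 1: "zip xs ys = map (\<lambda>i. (hd (drop i xs), hd (drop i ys))) [0..<if length xs \<le> length ys then length xs else length ys]"
    for xs :: "'b list" and ys :: "'c list"
    by (rule nth_equalityI) (auto simp: hd_drop_conv_nth split: if_splits)
  have "computable (\<lambda>p :: 'b list \<times> 'c list. zip (fst p) (snd p))"
    unfolding 1 by (intro computable_intros computable_hd)
  from computable_comp[OF this computable_Pair[OF assms]] show ?thesis by simp
qed

text \<open>The code of a pair of numbers is its \<open>prod_encode\<close>, so decoding leaves the
  code unchanged and the program for \<open>n\<close> already works.\<close>

lemma computable_prod_decode [computable_intros]:
  assumes "computable n" shows "computable (\<lambda>x. prod_decode (n x))"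
proof -
  have "code (prod_decode n) = code n" for n
    by (simp add: code_prod_def code_nat_def)
  then show ?thesis using assms by (simp add: computable_def)
qed

text \<open>This is the unbounded search of the algorithm; nothing is claimed for inputs without a
  witness. \<open>Mu\<close> looks for a zero, which is why the test enters as
  \<open>1 - code (P x)\<close>.\<close>

lemma search_program:
  fixes P :: "'a::coded \<times> nat \<Rightarrow> bool" and f :: "'a \<times> nat \<Rightarrow> 'b::coded"
  assumes "computable P" and "computable f"
  shows "\<exists>p. \<forall>x. (\<exists>n. P (x, n)) \<longrightarrow> run p [code x] = Some (code (f (x, LEAST n. P (x, n))))"
proof -
  have "computable (\<lambda>x. 1 - code (P x))"
  proof (rule computable_diff)
    show "computable (\<lambda>x. code (P x))"
      using assms(1) by (simp add: computable_def code_nat_def)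
  qed (rule computable_const)
  then obtain q where q: "\<And>x. run q [code x] = Some (code (1 - code (P x)))"
    unfolding computable_def by blast
  obtain r where r: "\<And>x. run r [code x] = Some (code (f x))"
    using assms(2) unfolding computable_def by blast
  define m where "m = Mu (Comp q [Comp pair_prog [Proj 1, Proj 0]])"
  have "run (Comp r [Comp pair_prog [Proj 0, m]]) [code x] = Some (code (f (x, LEAST n. P (x, n))))"
    if "\<exists>n. P (x, n)" for x
  proof -
    have 1: "run (Comp q [Comp pair_prog [Proj 1, Proj 0]]) [n, code x] = Some (1 - code (P (x, n)))" for n
    proof -
      have "run (Comp pair_prog [Proj 1, Proj 0]) [n, code x] = Some (code (x, n))"
        by (subst run_Comp2) (auto simp: run_pair_prog code_prod_def code_nat_def)
      then show ?thesis by (simp add: run_Comp1 q code_nat_def)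
    qed
    have "run m [code x] = Some (LEAST n. 1 - code (P (x, n)) = 0)"
      unfolding m_def using that by (intro run_Mu[OF 1]) (auto simp: code_bool_def)
    also have "(LEAST n. 1 - code (P (x, n)) = 0) = (LEAST n. P (x, n))"
      by (rule arg_cong[of _ _ Least]) (auto simp: code_bool_def)
    finally have "run (Comp pair_prog [Proj 0, m]) [code x] = Some (code (x, LEAST n. P (x, n)))"
      by (subst run_Comp2) (auto simp: run_pair_prog code_prod_def code_nat_def)
    then show ?thesis by (simp add: run_Comp1 r)
  qed
  then show ?thesis by blast
qed

section \<open>Bi-infinite sequences\<close>

definition shift :: "int \<Rightarrow> (int \<Rightarrow> 'a) \<Rightarrow> (int \<Rightarrow> 'a)" where
  "shift k x = (\<lambda>i. x (i + k))"

definition agree :: "nat \<Rightarrow> (int \<Rightarrow> 'a) \<Rightarrow> (int \<Rightarrow> 'a) \<Rightarrow> bool" where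
  "agree m x y \<longleftrightarrow> (\<forall>i. \<bar>i\<bar> \<le> int m \<longrightarrow> x i = y i)"

text \<open>Accumulation in the product of discrete topologies. Compactness is used in this form, so
  that no subsequences have to be named.\<close>

definition cluster :: "(nat \<Rightarrow> int \<Rightarrow> 'a) \<Rightarrow> (int \<Rightarrow> 'a) \<Rightarrow> bool" where
  "cluster s y \<longleftrightarrow> (\<forall>m k. \<exists>n\<ge>k. agree m (s n) y)"

lemma shift_apply: "shift k x i = x (i + k)"
  by (simp add: shift_def)

lemma shift_shift [simp]: "shift k (shift l x) = shift (k + l) x"
  by (simp add: shift_def fun_eq_iff algebra_simps)

lemma shift_0 [simp]: "shift 0 x = x"
  by (simp add: shift_def)

lemma left_shift_eq: "left_shift = shift 1"
  by (simp add: left_shift_def shift_def fun_eq_iff)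

lemma shift_eq_iff: "shift k x = y \<longleftrightarrow> x = shift (- k) y"
  by (metis add.left_inverse add.right_inverse shift_0 shift_shift)

lemma agreeD: "agree m x y \<Longrightarrow> \<bar>i\<bar> \<le> int m \<Longrightarrow> x i = y i"
  by (simp add: agree_def)

lemma agree_mono: "agree n x y \<Longrightarrow> m \<le> n \<Longrightarrow> agree m x y"
  by (auto simp: agree_def)

lemma agree_sym: "agree n x y \<Longrightarrow> agree n y x"
  by (auto simp: agree_def)

lemma agree_trans: "agree n x y \<Longrightarrow> agree n y z \<Longrightarrow> agree n x z"
  by (auto simp: agree_def)

lemma agree_shift: "agree m x y \<Longrightarrow> n + nat \<bar>k\<bar> \<le> m \<Longrightarrow> agree n (shift k x) (shift k y)"
  by (auto simp: agree_def shift_apply)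

lemma length_window [simp]: "length (window x i n) = n"
  by (simp add: window_def)

lemma window_nth [simp]: "j < n \<Longrightarrow> window x i n ! j = x (i + int j)"
  by (simp add: window_def)

lemma window_eq_iff: "window x i n = window y j n \<longleftrightarrow> (\<forall>k<n. x (i + int k) = y (j + int k))"
  by (auto simp: list_eq_iff_nth_eq)

lemma window_shift: "window (shift k x) i n = window x (i + k) n"
  by (simp add: window_def algebra_simps shift_apply)

lemma take_drop_window:
  "j + m \<le> n \<Longrightarrow> take m (drop j (window x i n)) = window x (i + int j) m"
  by (rule nth_equalityI) (auto simp: algebra_simps)

lemma take_window: "m \<le> n \<Longrightarrow> take m (window x i n) = window x i m"
  using take_drop_window[of 0 m n x i] by simp

lemma agree_iff_window: "agree m x y \<longleftrightarrow> window x (- int m) (2 * m + 1) = window y (- int m) (2 * m + 1)"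
  (is "_ \<longleftrightarrow> ?w")
proof
  assume "agree m x y"
  then show ?w by (auto simp: window_eq_iff agree_def)
next
  assume w: ?w
  show "agree m x y"
    unfolding agree_def
  proof (intro allI impI)
    fix i assume "\<bar>i\<bar> \<le> int m"
    then have "nat (i + int m) < 2 * m + 1" "- int m + int (nat (i + int m)) = i" by linarith+
    then show "x i = y i"
      using w[unfolded window_eq_iff, rule_format, of "nat (i + int m)"] by simp
  qed
qed

lemma sublist_iff_take_drop:
  "sublist w v \<longleftrightarrow> (\<exists>j. j + length w \<le> length v \<and> w = take (length w) (drop j v))"
proof
  assume "sublist w v"
  then obtain ps ss where "v = ps @ w @ ss" by (auto simp: sublist_def)
  then show "\<exists>j. j + length w \<le> length v \<and> w = take (length w) (drop j v)"
    by (intro exI[of _ "length ps"]) simp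
next
  assume "\<exists>j. j + length w \<le> length v \<and> w = take (length w) (drop j v)"
  then obtain j where j: "w = take (length w) (drop j v)" by blast
  show "sublist w v"
    by (subst j) (meson sublist_order.order_trans sublist_drop sublist_take)
qed

lemma sublist_window:
  assumes "j \<le> i" and "i + int n \<le> j + int m"
  shows "sublist (window x i n) (window x j m)"
  unfolding sublist_iff_take_drop
  using assms by (intro exI[of _ "nat (i - j)"]) (simp add: take_drop_window)

lemma sublist_window_obtain:
  assumes "sublist w (window x i n)"
  obtains j where "w = window x j (length w)"
proof -
  from assms obtain j where "j + length w \<le> n" "w = take (length w) (drop j (window x i n))"
    by (auto simp: sublist_iff_take_drop)
  then have "w = window x (i + int j) (length w)" by (simp add: take_drop_window)
  then show thesis by (rule that)
qed

lemma infinite_fibre: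
  assumes "infinite I" and "f ` I \<subseteq> B" and "finite B"
  shows "\<exists>b\<in>B. infinite {i\<in>I. f i = b}"
proof -
  have "finite (f ` I)" using assms finite_subset by blast
  from pigeonhole_infinite[OF assms(1) this] show ?thesis
    using assms(2) by (auto simp: image_subset_iff)
qed

text \<open>Compactness of the full shift by the diagonal method: the coordinates are enumerated
  through \<open>int_decode\<close>, and a decreasing chain of infinite index sets fixes one more
  coordinate at each stage.\<close>

lemma cluster_exists:
  fixes s :: "nat \<Rightarrow> int \<Rightarrow> 'a"
  assumes "finite A" and s: "\<And>n i. s n i \<in> A"
  obtains y where "\<And>i. y i \<in> A" and "cluster s y"
proof -
  define c where "c m I J \<longleftrightarrow> J \<subseteq> I \<and> (\<exists>a\<in>A. \<forall>n\<in>J. s n (int_decode m) = a)"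
    for m :: nat and I J :: "nat set"
  have "\<exists>I. \<forall>m. infinite (I m) \<and> c m (I m) (I (Suc m))"
  proof (rule dependent_nat_choice)
    show "\<exists>I :: nat set. infinite I" using infinite_UNIV_nat by blast
    fix I :: "nat set" and m
    assume I: "infinite I"
    have "\<exists>a\<in>A. infinite {n\<in>I. s n (int_decode m) = a}"
      using I assms by (intro infinite_fibre) auto
    then show "\<exists>J. infinite J \<and> c m I J" unfolding c_def by blast
  qed
  then obtain I where inf: "\<And>m. infinite (I m)" and c: "\<And>m. c m (I m) (I (Suc m))"
    by blast
  have "\<exists>a. a \<in> A \<and> (\<forall>n\<in>I (Suc m). s n (int_decode m) = a)" for m
    using c[of m] unfolding c_def by blast
  then obtain a where a: "\<And>m. a m \<in> A" "\<And>m n. n \<in> I (Suc m) \<Longrightarrow> s n (int_decode m) = a m"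
    by metis
  have dec: "I n \<subseteq> I m" if "m \<le> n" for m n
    by (rule lift_Suc_antimono_le[OF _ that]) (use c in \<open>simp add: c_def\<close>)
  define y where "y i = a (int_encode i)" for i
  have "cluster s y"
    unfolding cluster_def
  proof (intro allI)
    fix m k :: nat
    obtain N where N: "\<And>i. \<bar>i\<bar> \<le> int m \<Longrightarrow> int_encode i \<le> N"
    proof -
      have "finite {- int m..int m}" by simp
      then have "finite (int_encode ` {- int m..int m})" by (rule finite_imageI)
      then obtain N where "\<forall>j\<in>int_encode ` {- int m..int m}. j \<le> N"
        using finite_nat_set_iff_bounded_le by blast
      then show thesis by (intro that[of N]) (simp add: abs_le_iff)
    qed
    obtain n where n: "n \<in> I (Suc N)" "n \<ge> k"
      using inf[of "Suc N"] by (meson infinite_nat_iff_unbounded_le)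
    have "s n i = y i" if "\<bar>i\<bar> \<le> int m" for i
    proof -
      have "n \<in> I (Suc (int_encode i))" using n(1) dec[of "Suc (int_encode i)" "Suc N"] N[OF that] by auto
      from a(2)[OF this] show ?thesis by (simp add: y_def)
    qed
    with n(2) show "\<exists>n\<ge>k. agree m (s n) y" by (auto simp: agree_def)
  qed
  moreover have "\<And>i. y i \<in> A" by (simp add: y_def a(1))
  ultimately show thesis by (rule that[rotated])
qed

section \<open>Substitutions of constant length\<close>

text \<open>The image of \<open>x\<close>, placed so that the block of the letter at 0 begins at 0.
  As \<open>div\<close> rounds down, the formula also covers negative positions.\<close>

definition subst_seq :: "nat \<Rightarrow> ('a \<Rightarrow> 'a list) \<Rightarrow> (int \<Rightarrow> 'a) \<Rightarrow> (int \<Rightarrow> 'a)" where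
  "subst_seq L \<alpha> x = (\<lambda>i. \<alpha> (x (i div int L)) ! nat (i mod int L))"

locale primitive_const =
  fixes L :: nat and A :: "'a set" and \<alpha> :: "'a \<Rightarrow> 'a list"
  assumes L: "1 < L" and subst: "substitution A \<alpha>" and const_length: "constant_length L A \<alpha>"
    and prim: "primitive_subst A \<alpha>" and infinite_space: "infinite (subst_space A \<alpha>)"
begin

abbreviation "Lang \<equiv> subst_language A \<alpha>"
abbreviation "X \<equiv> subst_space A \<alpha>"
abbreviation "S \<equiv> subst_seq L \<alpha>"
abbreviation "sw n \<equiv> (subst_word \<alpha> ^^ n)"

lemma finite_A: "finite A" and A_lists: "a \<in> A \<Longrightarrow> \<alpha> a \<in> lists A"
  using subst by (auto simp: substitution_def)

lemma len: "a \<in> A \<Longrightarrow> length (\<alpha> a) = L"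
  using const_length by (simp add: constant_length_def)

lemma subst_word_append: "subst_word \<alpha> (u @ v) = subst_word \<alpha> u @ subst_word \<alpha> v"
  by (simp add: subst_word_def)

lemma sw_append: "sw n (u @ v) = sw n u @ sw n v"
  by (induction n) (simp_all add: subst_word_append)

lemma sw_lists: "w \<in> lists A \<Longrightarrow> sw n w \<in> lists A"
proof (induction n)
  case (Suc n)
  then have "sw n w \<in> lists A" by simp
  moreover have "subst_word \<alpha> v \<in> lists A" if "v \<in> lists A" for v
    using that A_lists by (induction v) (auto simp: subst_word_def)
  ultimately show ?case by simp
qed simp

lemma length_subst_word: "w \<in> lists A \<Longrightarrow> length (subst_word \<alpha> w) = L * length w"
  by (induction w) (auto simp: subst_word_def len)

lemma length_sw: "w \<in> lists A \<Longrightarrow> length (sw n w) = L ^ n * length w"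
  by (induction n) (simp_all add: length_subst_word sw_lists)

lemma drop_sw: 
  assumes "w \<in> lists A" and "j \<le> length w" 
  shows "drop (L ^ n * j) (sw n w) = sw n (drop j w)"
proof -
  have "take j w \<in> lists A" using assms(1) by (auto dest: in_set_takeD)
  then have "length (sw n (take j w)) = L ^ n * j" using assms(2) by (simp add: length_sw)
  moreover have "sw n w = sw n (take j w) @ sw n (drop j w)" by (simp flip: sw_append)
  ultimately show ?thesis by simp
qed

lemma take_sw: 
  assumes "w \<in> lists A" and "j \<le> length w" 
  shows "take (L ^ n * j) (sw n w) = sw n (take j w)"
proof -
  have "take j w \<in> lists A" using assms(1) by (auto dest: in_set_takeD)
  then have "length (sw n (take j w)) = L ^ n * j" using assms(2) by (simp add: length_sw)
  moreover have "sw n w = sw n (take j w) @ sw n (drop j w)" by (simp flip: sw_append)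
  ultimately show ?thesis by simp
qed

lemma block_sw:
  assumes "w \<in> lists A" and "j < length w" 
  shows "take (L ^ n) (drop (L ^ n * j) (sw n w)) = sw n [w ! j]"
proof -
  have "drop j w \<in> lists A" using assms(1) by (auto dest: in_set_dropD)
  then have "take (L ^ n * 1) (sw n (drop j w)) = sw n (take 1 (drop j w))"
    using assms by (intro take_sw) auto
  moreover have "take 1 (drop j w) = [w ! j]"
    using assms(2) by (simp add: take_Suc_conv_app_nth flip: Cons_nth_drop_Suc)
  ultimately show ?thesis using drop_sw[OF assms(1)] assms(2) by simp
qed

lemma sublist_sw: "sublist u v \<Longrightarrow> sublist (sw n u) (sw n v)"
  unfolding sublist_def using sw_append by metis

lemma Lang_sublist: "w \<in> Lang \<Longrightarrow> sublist v w \<Longrightarrow> v \<in> Lang"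
  unfolding subst_language_def using sublist_order.order_trans by blast

lemma Lang_lists: "w \<in> Lang \<Longrightarrow> w \<in> lists A"
proof -
  assume "w \<in> Lang"
  then obtain a n where "a \<in> A" "sublist w (sw n [a])"
    unfolding subst_language_def by blast
  then show ?thesis
    using sw_lists[of "[a]" n] set_mono_sublist[of w "sw n [a]"] by (auto simp: in_lists_conv_set)
qed

lemma sw_in_Lang: "w \<in> Lang \<Longrightarrow> sw n w \<in> Lang"
proof -
  assume "w \<in> Lang"
  then obtain a k where "a \<in> A" "k \<ge> 1" "sublist w (sw k [a])"
    unfolding subst_language_def by blast
  then have "a \<in> A" "n + k \<ge> 1" "sublist (sw n w) (sw (n + k) [a])"
    by (auto simp: funpow_add intro: sublist_sw)
  then show ?thesis unfolding subst_language_def by blast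
qed

lemma prim_obtain:
  obtains p where "p \<ge> 1" and "\<And>a b. a \<in> A \<Longrightarrow> b \<in> A \<Longrightarrow> a \<in> set (sw p [b])"
proof -
  obtain p where "p > 0" "\<forall>b\<in>A. A \<subseteq> set (sw p [b])"
    using prim unfolding primitive_subst_def by blast
  then show thesis by (intro that[of p]) (simp_all add: subset_iff)
qed

lemma sublist_singleton: "a \<in> set w \<Longrightarrow> sublist [a] w"
  by (auto simp: sublist_def in_set_conv_decomp)

text \<open>By primitivity the letter that produces \<open>w\<close> occurs in
  \<open>sw p [b]\<close> for every \<open>b\<close>, so a single exponent serves all
  letters.\<close>

lemma Lang_uniform:
  assumes "w \<in> Lang"
  obtains q where "q \<ge> 1" and "\<And>b. b \<in> A \<Longrightarrow> sublist w (sw q [b])"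
proof -
  obtain a k where k: "a \<in> A" "k \<ge> 1" "sublist w (sw k [a])"
    using assms unfolding subst_language_def by blast
  obtain p where p: "p \<ge> 1" "\<And>a b. a \<in> A \<Longrightarrow> b \<in> A \<Longrightarrow> a \<in> set (sw p [b])"
    using prim_obtain by blast
  have "sublist w (sw (k + p) [b])" if "b \<in> A" for b
  proof -
    have "sublist (sw k [a]) (sw k (sw p [b]))"
      using p(2)[OF k(1) that] by (intro sublist_sw sublist_singleton)
    with k(3) show ?thesis by (simp add: funpow_add)
  qed
  then show thesis using k(2) by (intro that[of "k + p"]) auto
qed

lemma S_maps: "(\<And>i. x i \<in> A) \<Longrightarrow> S x i \<in> A"
proof -
  assume x: "\<And>i. x i \<in> A"
  have "nat (i mod int L) < length (\<alpha> (x (i div int L)))"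
    using L x by (simp add: len nat_less_iff)
  then have "S x i \<in> set (\<alpha> (x (i div int L)))" by (simp add: subst_seq_def)
  then show ?thesis using A_lists[OF x] by auto
qed

lemma Sn_maps: "(\<And>i. x i \<in> A) \<Longrightarrow> (S ^^ n) x i \<in> A"
  by (induction n arbitrary: i) (simp_all add: S_maps)

lemma S_window:
  assumes x: "\<And>i. x i \<in> A"
  shows "window (S x) (int L * i) (L * n) = subst_word \<alpha> (window x i n)"
proof (induction n)
  case 0
  show ?case by (simp add: window_def subst_word_def)
next
  case (Suc n)
  have split: "window y j (m + k) = window y j m @ window y (j + int m) k" for y :: "int \<Rightarrow> 'a" and j m k
    by (rule nth_equalityI) (auto simp: nth_append)
  have "window (S x) (int L * (i + int n)) L = \<alpha> (x (i + int n))"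
  proof (rule nth_equalityI)
    fix j assume "j < length (window (S x) (int L * (i + int n)) L)"
    then have j: "j < L" by simp
    have "(int L * (i + int n) + int j) div int L = i + int n"
      using j by simp
    moreover have "(int L * (i + int n) + int j) mod int L = int j"
      using j by simp
    ultimately show "window (S x) (int L * (i + int n)) L ! j = \<alpha> (x (i + int n)) ! j"
      using j by (simp add: subst_seq_def)
  qed (simp add: len x)
  moreover have "window (S x) (int L * i) (L * Suc n)
      = window (S x) (int L * i) (L * n) @ window (S x) (int L * (i + int n)) L"
    using split[of "S x" "int L * i" "L * n" L] by (simp add: algebra_simps)
  moreover have "window x i (Suc n) = window x i n @ [x (i + int n)]"
    by (simp add: window_def)
  ultimately show ?case by (simp add: Suc subst_word_append) (simp add: subst_word_def)
qed

lemma Sn_window: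
  assumes x: "\<And>i. x i \<in> A"
  shows "window ((S ^^ k) x) (int L ^ k * i) (L ^ k * n) = sw k (window x i n)"
proof (induction k)
  case (Suc k)
  have "window (S ((S ^^ k) x)) (int L * (int L ^ k * i)) (L * (L ^ k * n))
      = subst_word \<alpha> (window ((S ^^ k) x) (int L ^ k * i) (L ^ k * n))"
    by (intro S_window Sn_maps x)
  then show ?case by (simp add: Suc mult.assoc)
qed simp

lemma Sn_apply:
  assumes x: "\<And>i. x i \<in> A" and j: "j < L ^ k"
  shows "(S ^^ k) x (int L ^ k * i + int j) = sw k [x i] ! j"
proof -
  have "sw k (window x i 1) ! j = window ((S ^^ k) x) (int L ^ k * i) (L ^ k * 1) ! j"
    by (simp only: Sn_window[OF x])
  then show ?thesis using j by (simp add: window_def)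
qed

lemma S_shift: "S (shift k x) = shift (int L * k) (S x)"
  using L by (simp add: subst_seq_def fun_eq_iff shift_apply add.commute)

lemma Sn_shift: "(S ^^ n) (shift k x) = shift (int L ^ n * k) ((S ^^ n) x)"
  by (induction n) (simp_all add: S_shift mult.assoc)

text \<open>\<open>S x\<close> at \<open>i\<close> depends only on the letter of \<open>x\<close> at
  \<open>i div L\<close>, which is no farther from 0 than \<open>i\<close>; so no radius is
  lost.\<close>

lemma agree_S: "agree m x y \<Longrightarrow> agree m (S x) (S y)"
  unfolding agree_def
proof (intro allI impI)
  fix i assume xy: "\<forall>i. \<bar>i\<bar> \<le> int m \<longrightarrow> x i = y i" and i: "\<bar>i\<bar> \<le> int m"
  have "\<bar>i div int L\<bar> \<le> int m"
  proof (cases "i \<ge> 0")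
    case True
    then have "0 \<le> i div int L" "i div int L \<le> i"
      using L zdiv_mono2[of i 1 "int L"] by (auto simp: pos_imp_zdiv_nonneg_iff)
    with i show ?thesis by simp
  next
    case False
    then have "i div int L < 0" using L by (simp add: pos_imp_zdiv_neg_iff)
    moreover have "i \<le> i div int L"
    proof -
      have "i * int L \<le> i * 1" using L False by (intro mult_left_mono_neg) auto
      then have "i * int L \<le> i" by simp
      then have "i * int L div int L \<le> i div int L" using L by (intro zdiv_mono1) auto
      then show ?thesis using L by simp
    qed
    ultimately show ?thesis using i by simp
  qed
  with xy show "S x i = S y i" by (simp add: subst_seq_def)
qed

lemma agree_Sn: "agree m x y \<Longrightarrow> agree m ((S ^^ n) x) ((S ^^ n) y)"
  by (induction n) (simp_all add: agree_S)

lemma X_A: "x \<in> X \<Longrightarrow> x i \<in> A"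
  by (auto simp: subst_space_def)

lemma X_window: "x \<in> X \<Longrightarrow> window x i n \<in> Lang"
  by (auto simp: subst_space_def)

lemma X_I: "(\<And>i. x i \<in> A) \<Longrightarrow> (\<And>i n. window x i n \<in> Lang) \<Longrightarrow> x \<in> X"
  by (auto simp: subst_space_def)

lemma X_shift: "x \<in> X \<Longrightarrow> shift k x \<in> X"
  by (rule X_I) (simp_all add: X_A window_shift X_window shift_apply)

lemma X_Sn: "x \<in> X \<Longrightarrow> (S ^^ k) x \<in> X"
proof (rule X_I)
  assume x: "x \<in> X"
  fix i n
  have "L ^ k > 0" using L by simp
  then have "1 * n \<le> L ^ k * n" by (intro mult_le_mono1) linarith
  then have "n \<le> L ^ k * n" by simp
  then have "int n \<le> int (L ^ k * n)" by (simp only: of_nat_le_iff)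
  moreover have "i mod int L ^ k < int L ^ k" "i mod int L ^ k \<ge> 0" using L by simp_all
  moreover have "int L ^ k * (i div int L ^ k) + i mod int L ^ k = i" by (rule mult_div_mod_eq)
  moreover have "int (L ^ k * (n + 1)) = int (L ^ k * n) + int L ^ k" by simp
  ultimately have "sublist (window ((S ^^ k) x) i n)
      (window ((S ^^ k) x) (int L ^ k * (i div int L ^ k)) (L ^ k * (n + 1)))"
    by (intro sublist_window) linarith+
  also have "window ((S ^^ k) x) (int L ^ k * (i div int L ^ k)) (L ^ k * (n + 1))
      = sw k (window x (i div int L ^ k) (n + 1))"
    by (rule Sn_window) (rule X_A[OF x])
  finally show "window ((S ^^ k) x) i n \<in> Lang"
    using x by (meson Lang_sublist sw_in_Lang X_window)
qed (simp add: Sn_maps X_A)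

lemma X_cluster:
  assumes "\<And>n. s n \<in> X" and "cluster s y" and "\<And>i. y i \<in> A"
  shows "y \<in> X"
proof (rule X_I)
  fix i n
  obtain k where "agree (nat \<bar>i\<bar> + n) (s k) y"
    using assms(2) unfolding cluster_def by blast
  then have "window (s k) i n = window y i n"
    by (auto simp: window_eq_iff agree_def)
  then show "window y i n \<in> Lang" using X_window[OF assms(1)] by metis
qed (rule assms(3))

lemma X_cluster_exists:
  assumes "\<And>n. s n \<in> X"
  obtains y where "y \<in> X" and "cluster s y"
proof -
  obtain y where "\<And>i. y i \<in> A" "cluster s y"
    using cluster_exists[OF finite_A, of s] X_A[OF assms] by blast
  with X_cluster[of s y] assms that show thesis by blast
qed

section \<open>Minimality and existence of desubstitutions\<close>

text \<open>A stretch of \<open>2 * Q\<close> letters of \<open>x\<close> lies in some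
  \<open>sw k [c]\<close>, a concatenation of blocks \<open>sw q [b]\<close> of length
  \<open>Q\<close>. It contains a whole block, and every such block contains
  \<open>w\<close>.\<close>

lemma recurrence:
  assumes w: "w \<in> Lang" and x: "x \<in> X"
  obtains i where "window x i (length w) = w"
proof -
  obtain q where q: "\<And>b. b \<in> A \<Longrightarrow> sublist w (sw q [b])"
    using Lang_uniform[OF w] by blast
  define Q where "Q = L ^ q"
  have Q: "Q > 0" using L by (simp add: Q_def)
  obtain c k where c: "c \<in> A" "sublist (window x 0 (2 * Q)) (sw k [c])"
    using X_window[OF x, of 0 "2 * Q"] unfolding subst_language_def by blast
  have len_k: "length (sw k [c]) = L ^ k" using c(1) by (simp add: length_sw)
  have "2 * Q \<le> L ^ k" using sublist_length_le[OF c(2)] by (simp add: len_k)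
  then have "L ^ q \<le> L ^ k" using Q by (simp add: Q_def)
  then have kq: "q \<le> k" using L by simp
  define v where "v = sw (k - q) [c]"
  have v: "v \<in> lists A" unfolding v_def using c(1) by (intro sw_lists) simp
  have sw_v: "sw q v = sw k [c]"
    unfolding v_def using kq by (metis comp_apply funpow_add le_add_diff_inverse)
  have len_v: "Q * length v = L ^ k" using length_sw[OF v, of q] by (simp add: sw_v len_k Q_def)
  obtain t where t: "t + 2 * Q \<le> L ^ k" "window x 0 (2 * Q) = take (2 * Q) (drop t (sw q v))"
    using c(2) by (auto simp: sublist_iff_take_drop len_k sw_v)
  \<comment> \<open>Index of the first block of \<open>sw q v\<close> that begins at or after
    \<open>t\<close>; it ends within the \<open>2 * Q\<close> letters read from
    \<open>t\<close>.\<close>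
  define j where "j = (t + Q - 1) div Q"
  have "Q * j \<le> t + Q - 1" unfolding j_def by simp
  moreover have "t + Q - 1 < Q * j + Q"
    unfolding j_def using Q dividend_less_times_div[of Q "t + Q - 1"] by (simp add: algebra_simps)
  ultimately have j: "t \<le> Q * j" "Q * j + Q \<le> t + 2 * Q" using Q by linarith+
  then have "Q * (j + 1) \<le> Q * length v" using t(1) by (simp add: len_v)
  then have jv: "j < length v" using Q by (simp only: mult_le_cancel1) simp
  have "take Q (drop (Q * j - t) (window x 0 (2 * Q))) = take Q (drop (Q * j) (sw q v))"
    using j unfolding t(2) by (simp add: drop_take)
  also have "\<dots> = sw q [v ! j]" unfolding Q_def by (rule block_sw[OF v jv])
  finally have "sublist (sw q [v ! j]) (window x 0 (2 * Q))"
    by (metis sublist_drop sublist_order.order_trans sublist_take)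
  moreover have "v ! j \<in> A" using v jv by (auto simp: in_lists_conv_set)
  ultimately have "sublist w (window x 0 (2 * Q))" using q sublist_order.order_trans by blast
  then show thesis by (rule sublist_window_obtain) (metis that)
qed

lemma orbit_dense:
  assumes "x \<in> X" and "y \<in> X"
  obtains q where "agree m (shift q x) y"
proof -
  obtain i where "window x i (2 * m + 1) = window y (- int m) (2 * m + 1)"
    using recurrence[OF X_window[OF assms(2), of "- int m" "2 * m + 1"] assms(1)] by auto
  then have "agree m (shift (i + int m) x) y"
    by (simp add: agree_iff_window window_shift)
  then show thesis by (rule that)
qed

text \<open>Translates of \<open>(S ^^ n) x\<close> itself approximate \<open>x\<close> by density
  of orbits. The part of the translation divisible by \<open>L ^ n\<close> moves inside
  \<open>S ^^ n\<close>, which leaves a bounded offset, and compactness turns the approximations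
  into an equality. Uniqueness is a separate matter.\<close>

lemma desubstitution:
  assumes x: "x \<in> X"
  obtains r y where "y \<in> X" and "0 \<le> r" and "r < int L ^ n" and "x = shift r ((S ^^ n) y)"
proof -
  let ?Q = "int L ^ n"
  have Q: "?Q > 0" using L by simp
  have "\<exists>z r. z \<in> X \<and> r \<in> {0..<?Q} \<and> agree m (shift r ((S ^^ n) z)) x" for m
  proof -
    obtain p where p: "agree m (shift p ((S ^^ n) x)) x"
      using orbit_dense[OF X_Sn[OF x] x] .
    have "shift p ((S ^^ n) x) = shift (p mod ?Q) ((S ^^ n) (shift (p div ?Q) x))"
      by (simp add: Sn_shift)
    with p show ?thesis using Q X_shift[OF x]
      by (intro exI[of _ "shift (p div ?Q) x"] exI[of _ "p mod ?Q"]) simp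
  qed
  then obtain z r where z: "\<And>m. z m \<in> X" and r: "\<And>m. r m \<in> {0..<?Q}"
    and zr: "\<And>m. agree m (shift (r m) ((S ^^ n) (z m))) x"
    by metis
  \<comment> \<open>Point and offset are clustered as one sequence of pairs, the offset repeated at
    every position, so that both settle along the same indices.\<close>
  obtain u where u: "\<And>i. u i \<in> A \<times> {0..<?Q}" and cl: "cluster (\<lambda>m i. (z m i, r m)) u"
    by (rule cluster_exists[of "A \<times> {0..<?Q}" "\<lambda>m i. (z m i, r m)"])
      (use finite_A z r X_A in auto)
  define y where "y i = fst (u i)" for i
  define k where "k = snd (u 0)"
  have near: "\<exists>l\<ge>m. agree m (z l) y \<and> r l = k" for m
  proof -
    obtain l where l: "l \<ge> m" "agree m (\<lambda>i. (z l i, r l)) u"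
      using cl unfolding cluster_def by blast
    have "agree m (z l) y" unfolding agree_def y_def
    proof (intro allI impI)
      fix i assume "\<bar>i\<bar> \<le> int m"
      from agreeD[OF l(2) this] show "z l i = fst (u i)" by (metis fst_conv)
    qed
    moreover have "r l = k" using agreeD[OF l(2), of 0] by (metis abs_zero k_def of_nat_0_le_iff snd_conv)
    ultimately show ?thesis using l(1) by blast
  qed
  have "y \<in> X"
  proof (rule X_cluster[OF z])
    show "cluster z y"
      unfolding cluster_def
    proof (intro allI)
      fix m k
      obtain l where "l \<ge> max m k" "agree (max m k) (z l) y" using near by blast
      then show "\<exists>n\<ge>k. agree m (z n) y" by (intro exI[of _ l]) (auto intro: agree_mono)
    qed
    show "y i \<in> A" for i using u[of i] by (auto simp: y_def)
  qed
  moreover have "x = shift k ((S ^^ n) y)"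
  proof
    fix i
    obtain l where l: "l \<ge> nat \<bar>i\<bar> + nat \<bar>k\<bar>" "agree (nat \<bar>i\<bar> + nat \<bar>k\<bar>) (z l) y" "r l = k"
      using near by blast
    have "x i = (S ^^ n) (z l) (i + k)"
      using agreeD[OF zr[of l], of i] l(1,3) by (simp add: shift_apply)
    also have "\<dots> = (S ^^ n) y (i + k)"
      by (rule agreeD[OF agree_Sn[OF l(2)]]) simp
    finally show "x i = shift k ((S ^^ n) y) i" by (simp add: shift_apply)
  qed
  moreover have "k \<in> {0..<?Q}" using u[of 0] by (auto simp: k_def)
  ultimately show thesis using that by auto
qed

end

section \<open>Recognizability\<close>

lemma int_subgroup_generator:
  fixes H :: "int set"
  assumes diff: "\<And>a b. a \<in> H \<Longrightarrow> b \<in> H \<Longrightarrow> a - b \<in> H" and k: "k \<in> H" "k > 0"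
  obtains d :: nat where "d > 0" and "H = {k. int d dvd k}"
proof -
  let ?P = "\<lambda>d :: nat. d > 0 \<and> int d \<in> H"
  define d where "d = (LEAST d. ?P d)"
  have "?P (nat k)" using k by simp
  then have d: "?P d" unfolding d_def by (rule LeastI[of ?P])
  have min: "d \<le> m" if "?P m" for m unfolding d_def by (rule Least_le[of ?P, OF that])
  have zero: "0 \<in> H" using diff[OF k(1) k(1)] by simp
  have uminus: "- a \<in> H" if "a \<in> H" for a using diff[OF zero that] by simp
  have add: "a + b \<in> H" if "a \<in> H" "b \<in> H" for a b using diff[OF that(1) uminus[OF that(2)]] by simp
  have nmult: "int n * a \<in> H" if "a \<in> H" for n a
    by (induction n) (simp_all add: zero add that distrib_right)
  have mult: "q * int d \<in> H" for q
  proof (cases "q \<ge> 0")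
    case True
    then show ?thesis using nmult[of "int d" "nat q"] d by simp
  next
    case False
    then show ?thesis using uminus[OF nmult[of "int d" "nat (- q)"]] d by simp
  qed
  have "int d dvd a" if "a \<in> H" for a
  proof (rule ccontr)
    assume "\<not> int d dvd a"
    then have "a mod int d > 0" using d by (metis dvd_eq_mod_eq_0 of_nat_0_less_iff order_le_less pos_mod_sign)
    moreover have "a mod int d \<in> H"
      using diff[OF that mult[of "a div int d"]] by (simp add: minus_div_mult_eq_mod)
    ultimately have "d \<le> nat (a mod int d)" by (intro min) simp
    moreover have "a mod int d < int d" using d by simp
    ultimately show False using \<open>a mod int d > 0\<close> by linarith
  qed
  then have "H = {k. int d dvd k}" using mult by (auto simp: dvd_def mult.commute)
  with d that show thesis by blast
qed

context primitive_const
begin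

section \<open>Word complexity\<close>

definition windows :: "nat \<Rightarrow> 'a list set" where
  "windows m = (\<lambda>x. window x 0 m) ` X"

lemma finite_windows: "finite (windows m)"
proof (rule finite_subset)
  show "windows m \<subseteq> {w. set w \<subseteq> A \<and> length w = m}"
    unfolding windows_def using X_A by (auto simp: window_def)
qed (rule finite_lists_length_eq[OF finite_A])

lemma windows_I: "x \<in> X \<Longrightarrow> window x i m \<in> windows m"
  unfolding windows_def by (rule image_eqI[OF _ X_shift[of x i]]) (simp_all add: window_shift)

lemma X_nonempty: "X \<noteq> {}"
  using infinite_space by auto

text \<open>Morse--Hedlund: if windows of length \<open>m\<close> extended uniquely to the right, then distinct points
  could be told apart by far-left windows of length \<open>m\<close>, so there would be finitely many.\<close>

lemma card_windows_strict: "card (windows m) < card (windows (Suc m))"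
proof (rule ccontr)
  assume "\<not> card (windows m) < card (windows (Suc m))"
  moreover have img: "take m ` windows (Suc m) = windows m"
    unfolding windows_def image_image by (simp add: take_window)
  ultimately have "card (take m ` windows (Suc m)) = card (windows (Suc m))"
    using card_image_le[OF finite_windows, of "take m" "Suc m"] by simp
  then have inj: "inj_on (take m) (windows (Suc m))"
    by (rule eq_card_imp_inj_on[OF finite_windows])
  have step: "x (i + int m) = y (j + int m)"
    if "x \<in> X" "y \<in> X" "window x i m = window y j m" for x y i j
  proof -
    have "window x i (Suc m) \<in> windows (Suc m)" "window y j (Suc m) \<in> windows (Suc m)"
      using that by (simp_all add: windows_I)
    moreover have "take m (window x i (Suc m)) = take m (window y j (Suc m))"
      using that(3) by (simp add: take_window)
    ultimately have "window x i (Suc m) = window y j (Suc m)" using inj by (auto dest: inj_onD)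
    then show ?thesis by (simp add: window_eq_iff)
  qed
  have ext: "x (i + int k) = y (i + int k)"
    if "x \<in> X" "y \<in> X" "window x i m = window y i m" for x y i k
  proof (induction k rule: less_induct)
    case (less k)
    show ?case
    proof (cases "k < m")
      case True
      with that(3) show ?thesis by (simp add: window_eq_iff)
    next
      case False
      have "window x (i + int (k - m)) m = window y (i + int (k - m)) m"
        unfolding window_eq_iff
      proof (intro allI impI)
        fix l assume "l < m"
        then have "x (i + int (k - m + l)) = y (i + int (k - m + l))"
          using False by (intro less.IH) simp
        then show "x (i + int (k - m) + int l) = y (i + int (k - m) + int l)"
          by (simp only: of_nat_add add.assoc)
      qed
      from step[OF that(1,2) this] False show ?thesis by (simp add: of_nat_diff)
    qed
  qed
  obtain E where E: "finite E" "card E = Suc (card (windows m))" "E \<subseteq> X"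
    using infinite_arbitrarily_large[OF infinite_space] by blast
  have "\<forall>\<^sub>F j in sequentially. window x (- int j) m \<noteq> window y (- int j) m"
    if "x \<in> E" "y \<in> E" "x \<noteq> y" for x y
  proof -
    obtain i where i: "x i \<noteq> y i" using \<open>x \<noteq> y\<close> by blast
    have "window x (- int j) m \<noteq> window y (- int j) m" if "j \<ge> nat (- i)" for j
    proof
      assume "window x (- int j) m = window y (- int j) m"
      then have "x (- int j + int (nat (i + int j))) = y (- int j + int (nat (i + int j)))"
        using E(3) \<open>x \<in> E\<close> \<open>y \<in> E\<close> by (intro ext) auto
      moreover have "- int j + int (nat (i + int j)) = i" using that by simp
      ultimately show False using i by simp
    qed
    then show ?thesis unfolding eventually_sequentially by blast
  qed
  then have "\<forall>\<^sub>F j in sequentially. x \<noteq> y \<longrightarrow> window x (- int j) m \<noteq> window y (- int j) m"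
    if "x \<in> E" "y \<in> E" for x y using that by (cases "x = y") simp_all
  then have "\<forall>\<^sub>F j in sequentially. \<forall>x\<in>E. \<forall>y\<in>E. x \<noteq> y \<longrightarrow> window x (- int j) m \<noteq> window y (- int j) m"
    using E(1) by (intro eventually_ball_finite ballI) auto
  then obtain j where "\<forall>x\<in>E. \<forall>y\<in>E. x \<noteq> y \<longrightarrow> window x (- int j) m \<noteq> window y (- int j) m"
    by (auto simp: eventually_sequentially)
  then have "inj_on (\<lambda>x. window x (- int j) m) E" by (auto simp: inj_on_def)
  moreover have "(\<lambda>x. window x (- int j) m) ` E \<subseteq> windows m"
    using E(3) windows_I by auto
  ultimately have "card E \<le> card (windows m)" using finite_windows by (intro card_inj_on_le)
  with E(2) show False by simp
qed

lemma card_windows_gt: "m < card (windows m)"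
proof (induction m)
  case 0
  then show ?case using X_nonempty finite_windows[of 0] by (simp add: card_gt_0_iff windows_def)
next
  case (Suc m)
  with card_windows_strict[of m] show ?case by simp
qed

section \<open>Displacements between coinciding images\<close>

text \<open>Recognizability at level \<open>n\<close> says that this set consists of the multiples
  of \<open>L ^ n\<close> only.\<close>

definition overlaps :: "nat \<Rightarrow> int set" where
  "overlaps n = {k. \<exists>x\<in>X. \<exists>y\<in>X. (S ^^ n) x = shift k ((S ^^ n) y)}"

text \<open>Shifts of \<open>u\<close> approximate \<open>x\<close>, and the same shifts of
  \<open>v\<close> accumulate at a partner \<open>y\<close> of \<open>x\<close>. This makes
  displacements composable, so that they form a group.\<close>

lemma overlaps_everywhere:
  assumes "k \<in> overlaps n" and x: "x \<in> X"
  obtains y where "y \<in> X" and "(S ^^ n) x = shift k ((S ^^ n) y)"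
proof -
  obtain u v where u: "u \<in> X" and v: "v \<in> X" and uv: "(S ^^ n) u = shift k ((S ^^ n) v)"
    using assms unfolding overlaps_def by blast
  obtain q where q: "\<And>m. agree m (shift (q m) u) x"
  proof -
    have "\<exists>q. agree m (shift q u) x" for m using orbit_dense[OF u x] by blast
    then show thesis using that by metis
  qed
  define s where "s m = shift (q m) v" for m
  obtain y where y: "y \<in> X" "cluster s y"
    by (rule X_cluster_exists[of s]) (auto simp: s_def X_shift v)
  have "(S ^^ n) x = shift k ((S ^^ n) y)"
  proof
    fix i
    let ?m = "nat \<bar>i\<bar> + nat \<bar>k\<bar>"
    obtain l where l: "l \<ge> ?m" "agree ?m (s l) y" using y(2) unfolding cluster_def by blast
    have "(S ^^ n) x i = (S ^^ n) (shift (q l) u) i"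
      using l(1) by (intro agreeD[OF agree_Sn[OF agree_sym[OF q[of l]]]]) simp
    also have "\<dots> = (S ^^ n) (s l) (i + k)"
      by (simp add: Sn_shift uv s_def shift_apply algebra_simps)
    also have "\<dots> = (S ^^ n) y (i + k)"
      by (rule agreeD[OF agree_Sn[OF l(2)]]) simp
    finally show "(S ^^ n) x i = shift k ((S ^^ n) y) i" by (simp add: shift_apply)
  qed
  with y(1) that show thesis by blast
qed

lemma overlaps_diff:
  assumes "a \<in> overlaps n" and "b \<in> overlaps n"
  shows "a - b \<in> overlaps n"
proof -
  obtain x y where xy: "x \<in> X" "y \<in> X" "(S ^^ n) x = shift b ((S ^^ n) y)"
    using assms(2) unfolding overlaps_def by blast
  obtain z where z: "z \<in> X" "(S ^^ n) x = shift a ((S ^^ n) z)"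
    using overlaps_everywhere[OF assms(1) xy(1)] .
  have "(S ^^ n) y = shift (- b) (shift a ((S ^^ n) z))"
    by (metis xy(3) z(2) shift_eq_iff)
  then show ?thesis using xy z unfolding overlaps_def by force
qed

lemma power_in_overlaps: "int L ^ n \<in> overlaps n"
proof -
  obtain x where x: "x \<in> X" using X_nonempty by blast
  have "(S ^^ n) x = shift (int L ^ n) ((S ^^ n) (shift (- 1) x))"
    by (simp add: Sn_shift)
  then show ?thesis unfolding overlaps_def using x X_shift[OF x] by blast
qed

lemma overlaps_Suc: "k \<in> overlaps n \<Longrightarrow> int L * k \<in> overlaps (Suc n)"
proof -
  assume "k \<in> overlaps n"
  then obtain x y where "x \<in> X" "y \<in> X" "(S ^^ n) x = shift k ((S ^^ n) y)"
    unfolding overlaps_def by blast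
  moreover from this have "(S ^^ Suc n) x = shift (int L * k) ((S ^^ Suc n) y)"
    by (simp add: S_shift)
  ultimately show ?thesis unfolding overlaps_def by blast
qed

text \<open>Every point lies at distance less than \<open>d\<close> from an \<open>n\<close>-fold image, so a window of length
  \<open>L ^ n - d\<close> always fits into a single block \<open>\<alpha> ^ n (a)\<close>. This contradicts aperiodicity if \<open>d\<close> is
  small compared to \<open>L ^ n\<close>.\<close>

lemma overlaps_bound:
  assumes d: "int d \<in> overlaps n" "0 < d" "d \<le> L ^ n" and H: "overlaps n = {k. int d dvd k}"
  shows "L ^ n < (card A + 1) * d"
proof -
  let ?m = "L ^ n - d"
  have "windows ?m \<subseteq> (\<lambda>(i, a). take ?m (drop i (sw n [a]))) ` ({0..<d} \<times> A)"
  proof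
    fix w assume "w \<in> windows ?m"
    then obtain x where x: "x \<in> X" "w = window x 0 ?m" by (auto simp: windows_def)
    obtain i y where y: "y \<in> X" "x = shift i ((S ^^ n) y)" using desubstitution[OF x(1)] by metis
    have "- (int d * (i div int d)) \<in> overlaps n" unfolding H by simp
    then obtain z where z: "z \<in> X" "(S ^^ n) y = shift (- (int d * (i div int d))) ((S ^^ n) z)"
      using overlaps_everywhere y(1) by blast
    define j where "j = nat (i mod int d)"
    have j: "j < d" "int j = i mod int d" using d(2) by (auto simp: j_def nat_less_iff)
    have "i + - (int d * (i div int d)) = int j"
      unfolding j(2) by (simp add: minus_mult_div_eq_mod)
    then have x': "x = shift (int j) ((S ^^ n) z)"
      unfolding y(2) z(2) shift_shift by simp
    have "w = window ((S ^^ n) z) (int j) ?m" by (simp add: x(2) x' window_shift)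
    also have "\<dots> = take ?m (drop j (window ((S ^^ n) z) (int L ^ n * 0) (L ^ n * 1)))"
      using j(1) d(3) by (simp add: take_drop_window)
    also have "\<dots> = take ?m (drop j (sw n (window z 0 1)))"
      by (subst Sn_window) (simp_all add: X_A[OF z(1)])
    also have "window z 0 1 = [z 0]" by (simp add: window_def)
    finally show "w \<in> (\<lambda>(i, a). take ?m (drop i (sw n [a]))) ` ({0..<d} \<times> A)"
      using j(1) X_A[OF z(1)] by force
  qed
  then have "card (windows ?m) \<le> card ({0..<d} \<times> A)"
    using finite_A by (intro surj_card_le) auto
  also have "\<dots> = d * card A" by (simp add: card_cartesian_product)
  finally have "L ^ n - d < d * card A" using card_windows_gt[of ?m] by simp
  then show ?thesis by (simp add: algebra_simps)
qed

text \<open>The index \<open>e n\<close> of the subgroup generated by \<open>L ^ n\<close> in \<open>overlaps n\<close> is bounded and each value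
  divides the next, so it is eventually constant.\<close>

lemma overlaps_dvd:
  assumes k: "k \<in> overlaps j"
  shows "int L ^ j dvd k"
proof -
  have Lpos: "L ^ n > 0" for n using L by simp
  have "\<exists>d>0. overlaps n = {k. int d dvd k}" for n
    by (rule int_subgroup_generator[OF overlaps_diff power_in_overlaps]) (use L in auto)
  then obtain d where d: "\<And>n. d n > 0" "\<And>n. overlaps n = {k. int (d n) dvd k}" by metis
  have "d n dvd L ^ n" for n
    using power_in_overlaps[of n] unfolding d(2) by (simp flip: of_nat_power)
  then obtain e where e: "\<And>n. L ^ n = d n * e n" unfolding dvd_def by metis
  have e_pos: "e n > 0" for n using e[of n] Lpos[of n] by (cases "e n") simp_all
  have e_le: "e n \<le> card A + 1" for n
  proof -
    have "d n \<le> L ^ n" using e[of n] e_pos[of n] by simp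
    then have "d n * e n < (card A + 1) * d n"
      using overlaps_bound[of "d n" n] d by (simp flip: e)
    then have "d n * e n < d n * (card A + 1)" by (simp only: mult.commute)
    then have "e n < card A + 1" by (simp only: nat_mult_less_cancel_disj)
    then show ?thesis by simp
  qed
  have e_mono: "e n \<le> e (Suc n)" for n
  proof -
    have "int L * int (d n) \<in> overlaps (Suc n)" by (rule overlaps_Suc) (simp add: d(2))
    then have "d (Suc n) dvd L * d n" unfolding d(2) by (simp flip: of_nat_mult)
    then obtain c where c: "L * d n = d (Suc n) * c" by (auto simp: dvd_def)
    have "d (Suc n) * e (Suc n) = d (Suc n) * (c * e n)"
    proof -
      have "d (Suc n) * e (Suc n) = L * (d n * e n)" by (simp flip: e)
      also have "\<dots> = (L * d n) * e n" by simp
      finally show ?thesis by (simp only: c mult.assoc)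
    qed
    then have "e (Suc n) = c * e n" using d(1)[of "Suc n"] by simp
    moreover from this have "c > 0" using e_pos[of "Suc n"] by (cases c) simp_all
    ultimately show ?thesis by simp
  qed
  obtain N where N: "\<And>n. e n \<le> e N"
    using ex_has_greatest_nat[of "\<lambda>_. True" undefined e "card A + 2"] e_le
    by (metis add_2_eq_Suc' le_imp_less_Suc add.commute plus_1_eq_Suc)
  have "e N \<le> e (N + j)" by (rule lift_Suc_mono_le[of e]) (simp_all add: e_mono)
  with N have eN: "e (N + j) = e N" by (simp add: le_antisym)
  \<comment> \<open>From level \<open>N\<close> on the index stays the same, so each further level
    multiplies the generator \<open>d\<close> by \<open>L\<close>.\<close>
  have "d (N + j) * e N = L ^ j * d N * e N"
  proof -
    have "d (N + j) * e N = L ^ (N + j)" by (simp only: e[of "N + j"] eN)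
    also have "\<dots> = L ^ j * L ^ N" by (simp only: power_add mult.commute)
    finally show ?thesis by (simp only: e[of N] mult.assoc)
  qed
  then have "d (N + j) = L ^ j * d N" using e_pos[of N] by simp
  then have dvd: "int L ^ j dvd l" if "l \<in> overlaps (N + j)" for l
    using that unfolding d(2) by (auto elim: dvd_mult_left)
  \<comment> \<open>It remains to lift \<open>k\<close> from level \<open>j\<close> to level
    \<open>N + j\<close>. One of the two points is taken to be an \<open>N\<close>-fold image and
    the other is desubstituted \<open>N\<close> times; this changes \<open>k\<close> only by the
    multiple \<open>L ^ j * r\<close>.\<close>
  obtain x where x: "x \<in> X" using X_nonempty by blast
  obtain y where y: "y \<in> X" "(S ^^ j) ((S ^^ N) x) = shift k ((S ^^ j) y)"
    using overlaps_everywhere[OF k X_Sn[OF x]] .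
  obtain r u where u: "u \<in> X" "y = shift r ((S ^^ N) u)"
    using desubstitution[OF y(1)] by metis
  have swap: "(S ^^ j) ((S ^^ N) z) = (S ^^ (N + j)) z" for z
    by (metis add.commute comp_apply funpow_add)
  have "(S ^^ (N + j)) x = shift (k + int L ^ j * r) ((S ^^ (N + j)) u)"
    using y(2) unfolding u(2) by (simp add: Sn_shift swap)
  then have "k + int L ^ j * r \<in> overlaps (N + j)"
    unfolding overlaps_def using x u(1) by blast
  from dvd[OF this] show ?thesis by (simp add: dvd_add_left_iff)
qed

lemma Sn_eq_iff:
  assumes "\<And>i. x i \<in> A" and "\<And>i. y i \<in> A"
  shows "(S ^^ n) x = (S ^^ n) y \<longleftrightarrow> (\<forall>i. sw n [x i] = sw n [y i])"
proof
  assume eq: "(S ^^ n) x = (S ^^ n) y"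
  show "\<forall>i. sw n [x i] = sw n [y i]"
  proof
    fix i
    have "window ((S ^^ n) x) (int L ^ n * i) (L ^ n * 1) = window ((S ^^ n) y) (int L ^ n * i) (L ^ n * 1)"
      by (simp add: eq)
    then show "sw n [x i] = sw n [y i]"
      unfolding Sn_window[OF assms(1)] Sn_window[OF assms(2)] by (simp add: window_def)
  qed
next
  assume eq: "\<forall>i. sw n [x i] = sw n [y i]"
  show "(S ^^ n) x = (S ^^ n) y"
  proof
    fix i
    let ?Q = "int L ^ n"
    have Q: "?Q > 0" using L by simp
    then have j: "nat (i mod ?Q) < L ^ n" by (simp add: nat_less_iff)
    have "(S ^^ n) x (?Q * (i div ?Q) + int (nat (i mod ?Q)))
        = (S ^^ n) y (?Q * (i div ?Q) + int (nat (i mod ?Q)))"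
      by (simp only: Sn_apply[of x _ n, OF assms(1) j] Sn_apply[of y _ n, OF assms(2) j] eq)
    then show "(S ^^ n) x i = (S ^^ n) y i" using Q by simp
  qed
qed

text \<open>The kernels of the maps \<open>a \<mapsto> \<alpha> ^ n (a)\<close> stabilize. Desubstituting two points \<open>n\<close> times beyond that
  stage shows that \<open>\<alpha>\<close> is injective on \<open>X\<close> although it need not be injective on letters.\<close>

lemma S_inj: "inj_on S X"
proof (rule inj_onI)
  fix x y assume x: "x \<in> X" and y: "y \<in> X" and eq: "S x = S y"
  define K where "K n = {(a, b) \<in> A \<times> A. sw n [a] = sw n [b]}" for n
  have "card (K n) \<le> card (A \<times> A)" for n
    unfolding K_def using finite_A by (intro card_mono) auto
  then have "card (K n) < card (A \<times> A) + 1" for n by (simp add: less_Suc_eq_le)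
  then obtain n where n: "\<And>m. card (K m) \<le> card (K n)"
    using ex_has_greatest_nat[of "\<lambda>_. True" undefined "\<lambda>n. card (K n)"] by (metis (no_types))
  have "finite (K (Suc n))" unfolding K_def using finite_A by (auto intro: finite_subset[of _ "A \<times> A"])
  moreover have "K n \<subseteq> K (Suc n)" unfolding K_def by auto
  ultimately have K: "K (Suc n) = K n" using n[of "Suc n"] by (metis card_seteq)
  obtain i u where u: "u \<in> X" "x = shift i ((S ^^ n) u)" using desubstitution[OF x] by metis
  obtain j v where v: "v \<in> X" "y = shift j ((S ^^ n) v)" using desubstitution[OF y] by metis
  have *: "(S ^^ Suc n) u = shift (int L * (j - i)) ((S ^^ Suc n) v)"
    using eq unfolding u(2) v(2) S_shift shift_eq_iff[of "int L * i"] by (simp add: algebra_simps)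
  \<comment> \<open>Recognizability at level \<open>Suc n\<close> makes \<open>j - i\<close> a
    multiple of \<open>L ^ n\<close>, so the displacement is absorbed by passing from
    \<open>v\<close> to a shift of \<open>v\<close>.\<close>
  then have "int L * (j - i) \<in> overlaps (Suc n)" unfolding overlaps_def using u(1) v(1) by blast
  then have "int L ^ n dvd j - i" using overlaps_dvd[of _ "Suc n"] L by force
  then obtain t where t: "j - i = int L ^ n * t" by (auto simp: dvd_def)
  let ?v = "shift t v"
  have v': "?v \<in> X" using v(1) by (rule X_shift)
  have "(S ^^ Suc n) u = (S ^^ Suc n) ?v"
    using * unfolding t Sn_shift by (simp add: mult.assoc)
  then have "\<forall>l. sw (Suc n) [u l] = sw (Suc n) [?v l]"
    using Sn_eq_iff[of u ?v "Suc n"] X_A[OF u(1)] X_A[OF v'] by blast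
  then have "\<forall>l. (u l, ?v l) \<in> K (Suc n)" using X_A[OF u(1)] X_A[OF v'] by (auto simp: K_def)
  then have "\<forall>l. sw n [u l] = sw n [?v l]" unfolding K by (simp add: K_def)
  then have "(S ^^ n) u = (S ^^ n) ?v"
    using Sn_eq_iff[of u ?v n] X_A[OF u(1)] X_A[OF v'] by blast
  then have "x = shift (i + int L ^ n * t) ((S ^^ n) v)" by (simp add: u(2) Sn_shift)
  also have "i + int L ^ n * t = j" using t by simp
  finally show "x = y" by (simp add: v(2))
qed

section \<open>Local inversion of the substitution\<close>

text \<open>Uniform local form of the injectivity of \<open>S\<close> on \<open>X\<close>: letters
  may share their image, so the letter at 0 is recovered from the images of all letters up to
  distance \<open>M\<close>.\<close>

definition injectivity_radius :: "nat \<Rightarrow> bool" where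
  "injectivity_radius M \<longleftrightarrow>
    (\<forall>x\<in>X. \<forall>y\<in>X. (\<forall>i. \<bar>i\<bar> \<le> int M \<longrightarrow> \<alpha> (x i) = \<alpha> (y i)) \<longrightarrow> x 0 = y 0)"

lemma injectivity_radius_mono: "injectivity_radius M \<Longrightarrow> M \<le> N \<Longrightarrow> injectivity_radius N"
  unfolding injectivity_radius_def by force

text \<open>Counterexamples for all \<open>M\<close> would accumulate at two points with equal image
  under \<open>S\<close> but different letters at 0, contrary to \<open>S_inj\<close>.\<close>

lemma injectivity_radius_exists: "\<exists>M. injectivity_radius M"
proof (rule ccontr)
  assume "\<not> ?thesis"
  then obtain s t where st: "\<And>m. s m \<in> X" "\<And>m. t m \<in> X" "\<And>m. s m 0 \<noteq> t m 0"
    and eq: "\<And>m i. \<bar>i\<bar> \<le> int m \<Longrightarrow> \<alpha> (s m i) = \<alpha> (t m i)"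
    unfolding injectivity_radius_def by metis
  obtain z where z: "\<And>i. z i \<in> A \<times> A" and cl: "cluster (\<lambda>m i. (s m i, t m i)) z"
    by (rule cluster_exists[of "A \<times> A" "\<lambda>m i. (s m i, t m i)"]) (use finite_A st X_A in auto)
  define x y where "x i = fst (z i)" and "y i = snd (z i)" for i
  have near: "\<exists>l\<ge>k. agree m (s l) x \<and> agree m (t l) y" for m k
  proof -
    obtain l where l: "l \<ge> k" "agree m (\<lambda>i. (s l i, t l i)) z"
      using cl unfolding cluster_def by blast
    then have "agree m (s l) x \<and> agree m (t l) y"
      unfolding agree_def x_def y_def by (metis fst_conv snd_conv)
    with l(1) show ?thesis by blast
  qed
  have xy: "x i \<in> A" "y i \<in> A" for i using z[of i] by (auto simp: x_def y_def)
  have x: "x \<in> X" by (rule X_cluster[of s]) (use near xy st in \<open>auto simp: cluster_def\<close>, blast)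
  have y: "y \<in> X" by (rule X_cluster[of t]) (use near xy st in \<open>auto simp: cluster_def\<close>, blast)
  have "sw 1 [x i] = sw 1 [y i]" for i
  proof -
    obtain l where "l \<ge> nat \<bar>i\<bar>" "agree (nat \<bar>i\<bar>) (s l) x" "agree (nat \<bar>i\<bar>) (t l) y"
      using near by blast
    then have "\<alpha> (x i) = \<alpha> (y i)" using eq[of i l] by (simp add: agree_def)
    then show ?thesis by (simp add: subst_word_def)
  qed
  then have "(S ^^ 1) x = (S ^^ 1) y" using Sn_eq_iff[of x y 1] xy by blast
  then have "x = y" using S_inj x y by (auto dest: inj_onD)
  moreover obtain l where "agree 0 (s l) x" "agree 0 (t l) y" using near by blast
  ultimately have "s l 0 = t l 0" by (simp add: agree_def)
  with st(3) show False by simp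
qed

end

section \<open>Conjugacies as block maps\<close>

lemma topspace_subst_topology: "topspace (subst_topology A \<alpha>) = subst_space A \<alpha>"
  by (auto simp: subst_topology_def subst_space_def)

lemma openin_subst_topology:
  "openin (subst_topology A \<alpha>) U \<longleftrightarrow>
    U \<subseteq> subst_space A \<alpha> \<and> (\<forall>x\<in>U. \<exists>m. \<forall>z\<in>subst_space A \<alpha>. agree m x z \<longrightarrow> z \<in> U)"
  (is "_ \<longleftrightarrow> ?R")
proof
  assume "openin (subst_topology A \<alpha>) U"
  then obtain T where T: "openin (product_topology (\<lambda>_::int. discrete_topology A) UNIV) T"
    and U: "U = T \<inter> subst_space A \<alpha>"
    by (auto simp: subst_topology_def openin_subtopology)
  have "\<exists>m. \<forall>z\<in>subst_space A \<alpha>. agree m x z \<longrightarrow> z \<in> U" if "x \<in> U" for x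
  proof -
    have "x \<in> T" using that U by blast
    then obtain V where V: "finite {i. V i \<noteq> A}" "x \<in> Pi\<^sub>E UNIV V" "Pi\<^sub>E UNIV V \<subseteq> T"
      using T[unfolded openin_product_topology_alt] by auto
    have "finite ((\<lambda>i. nat \<bar>i\<bar>) ` {i. V i \<noteq> A})" using V(1) by (rule finite_imageI)
    then obtain m where m: "\<forall>j\<in>(\<lambda>i. nat \<bar>i\<bar>) ` {i. V i \<noteq> A}. j \<le> m"
      using finite_nat_set_iff_bounded_le by blast
    have "z \<in> U" if z: "z \<in> subst_space A \<alpha>" "agree m x z" for z
    proof -
      have "z i \<in> V i" for i
      proof (cases "V i = A")
        case True
        then show ?thesis using z(1) by (auto simp: subst_space_def)
      next
        case False
        then have "\<bar>i\<bar> \<le> int m" using m by auto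
        then have "x i = z i" by (rule agreeD[OF z(2)])
        moreover have "x i \<in> V i" using V(2) by (auto simp: PiE_iff)
        ultimately show ?thesis by simp
      qed
      then have "z \<in> T" using V(3) by (auto simp: PiE_iff)
      then show ?thesis using U z(1) by blast
    qed
    then show ?thesis by blast
  qed
  then show ?R using U by blast
next
  assume ?R
  then obtain m where sub: "U \<subseteq> subst_space A \<alpha>"
    and m: "\<And>x z. x \<in> U \<Longrightarrow> z \<in> subst_space A \<alpha> \<Longrightarrow> agree (m x) x z \<Longrightarrow> z \<in> U"
    by metis
  define T where "T = {z. (\<forall>i. z i \<in> A) \<and> (\<exists>x\<in>U. agree (m x) x z)}"
  have "openin (product_topology (\<lambda>_::int. discrete_topology A) UNIV) T"
    unfolding openin_product_topology_alt
  proof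
    fix z assume "z \<in> T"
    then obtain x where x: "x \<in> U" "agree (m x) x z" and z: "\<And>i. z i \<in> A" by (auto simp: T_def)
    define V where "V i = (if \<bar>i\<bar> \<le> int (m x) then {z i} else A)" for i
    have "{i. V i \<noteq> A} \<subseteq> {- int (m x)..int (m x)}" by (auto simp: V_def abs_le_iff split: if_splits)
    then have "finite {i. V i \<noteq> A}" by (rule finite_subset) simp
    moreover have "\<forall>i. V i \<subseteq> A" using z by (auto simp: V_def)
    moreover have "z \<in> Pi\<^sub>E UNIV V" using z by (auto simp: V_def)
    moreover have "Pi\<^sub>E UNIV V \<subseteq> T"
    proof
      fix y assume "y \<in> Pi\<^sub>E UNIV V"
      then have y: "y i \<in> V i" for i by (auto simp: PiE_iff)
      have "y i \<in> A" for i using y[of i] z[of i] by (auto simp: V_def split: if_splits)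
      moreover have "agree (m x) z y" unfolding agree_def
      proof (intro allI impI)
        fix i assume "\<bar>i\<bar> \<le> int (m x)"
        then show "z i = y i" using y[of i] by (simp add: V_def)
      qed
      ultimately show "y \<in> T" using x agree_trans unfolding T_def by blast
    qed
    ultimately show "\<exists>V. finite {i \<in> UNIV. V i \<noteq> topspace (discrete_topology A)} \<and>
        (\<forall>i\<in>UNIV. openin (discrete_topology A) (V i)) \<and> z \<in> Pi\<^sub>E UNIV V \<and> Pi\<^sub>E UNIV V \<subseteq> T"
      by (intro exI[of _ V]) simp
  qed
  moreover have "U = T \<inter> subst_space A \<alpha>"
    using sub m by (auto simp: T_def subst_space_def agree_def)
  ultimately show "openin (subst_topology A \<alpha>) U"
    by (auto simp: subst_topology_def openin_subtopology)
qed

locale primitive_const_pair =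
  a: primitive_const L A \<alpha> + b: primitive_const L B \<beta>
  for L and A :: "'a set" and \<alpha> and B :: "'b set" and \<beta>
begin

text \<open>One radius bounds the map and its inverse. The bound on the inverse is what later makes
  injectivity testable on finitely many words.\<close>

definition block_conj :: "nat \<Rightarrow> ((int \<Rightarrow> 'a) \<Rightarrow> (int \<Rightarrow> 'b)) \<Rightarrow> bool" where
  "block_conj r F \<longleftrightarrow> bij_betw F a.X b.X \<and> (\<forall>x\<in>a.X. \<forall>k. F (shift k x) = shift k (F x)) \<and>
    (\<forall>x\<in>a.X. \<forall>y\<in>a.X. agree r x y \<longrightarrow> F x 0 = F y 0) \<and>
    (\<forall>x\<in>a.X. \<forall>y\<in>a.X. agree r (F x) (F y) \<longrightarrow> x 0 = y 0)"

lemma block_conjD: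
  assumes "block_conj r F"
  shows "bij_betw F a.X b.X" and "\<And>x k. x \<in> a.X \<Longrightarrow> F (shift k x) = shift k (F x)"
    and "\<And>x. x \<in> a.X \<Longrightarrow> F x \<in> b.X"
  using assms unfolding block_conj_def by (auto dest: bij_betwE)

lemma block_conj_agree:
  assumes F: "block_conj r F" and x: "x \<in> a.X" and y: "y \<in> a.X" and "agree n x y" and "m + r \<le> n"
  shows "agree m (F x) (F y)"
  unfolding agree_def
proof (intro allI impI)
  fix i assume "\<bar>i\<bar> \<le> int m"
  then have "agree r (shift i x) (shift i y)"
    using assms(4,5) by (intro agree_shift[of n]) auto
  then have "F (shift i x) 0 = F (shift i y) 0"
    using F a.X_shift[OF x] a.X_shift[OF y] unfolding block_conj_def by blast
  then show "F x i = F y i" by (simp add: block_conjD(2)[OF F] x y shift_apply)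
qed

lemma block_conj_agree_inverse:
  assumes F: "block_conj r F" and x: "x \<in> a.X" and y: "y \<in> a.X" and "agree n (F x) (F y)" and "m + r \<le> n"
  shows "agree m x y"
  unfolding agree_def
proof (intro allI impI)
  fix i assume "\<bar>i\<bar> \<le> int m"
  then have "agree r (shift i (F x)) (shift i (F y))"
    using assms(4,5) by (intro agree_shift[of n]) auto
  then have "agree r (F (shift i x)) (F (shift i y))"
    by (simp add: block_conjD(2)[OF F] x y)
  then have "shift i x 0 = shift i y 0"
    using F a.X_shift[OF x] a.X_shift[OF y] unfolding block_conj_def by blast
  then show "x i = y i" by (simp add: shift_apply)
qed

lemma block_conj_mono:
  assumes F: "block_conj r F" and "r \<le> r'"
  shows "block_conj r' F"
proof -
  have "agree r x y" if "agree r' x y" for x y :: "int \<Rightarrow> 'a" using agree_mono[OF that assms(2)] .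
  moreover have "agree r x y" if "agree r' x y" for x y :: "int \<Rightarrow> 'b" using agree_mono[OF that assms(2)] .
  ultimately show ?thesis using F unfolding block_conj_def by blast
qed

text \<open>Uniform continuity from compactness: pairs that agree ever farther but have images
  differing at 0 would accumulate at a common point, where continuity fails.\<close>

lemma local_of_continuous:
  assumes "continuous_map (subst_topology A \<alpha>) (subst_topology B \<beta>) f"
  shows "\<exists>r. \<forall>x\<in>a.X. \<forall>y\<in>a.X. agree r x y \<longrightarrow> f x 0 = f y 0"
proof (rule ccontr)
  assume "\<not> ?thesis"
  then obtain s t where st: "\<And>n. s n \<in> a.X" "\<And>n. t n \<in> a.X" "\<And>n. agree n (s n) (t n)"
    and neq: "\<And>n. f (s n) 0 \<noteq> f (t n) 0"
    by metis
  obtain x where x: "x \<in> a.X" "cluster s x" using a.X_cluster_exists[OF st(1)] .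
  have fX: "f z \<in> b.X" if "z \<in> a.X" for z
    using assms that by (auto simp: continuous_map_def topspace_subst_topology)
  have "openin (subst_topology B \<beta>) {z \<in> b.X. z 0 = f x 0}"
    unfolding openin_subst_topology by (auto intro!: exI[of _ 0] simp: agree_def)
  then have "openin (subst_topology A \<alpha>) {z \<in> a.X. f z \<in> {z \<in> b.X. z 0 = f x 0}}"
    using assms unfolding continuous_map_def topspace_subst_topology by blast
  then obtain m where m: "\<And>z. z \<in> a.X \<Longrightarrow> agree m x z \<Longrightarrow> f z 0 = f x 0"
    unfolding openin_subst_topology using x(1) fX[OF x(1)] by blast
  obtain n where n: "n \<ge> m" "agree m (s n) x" using x(2) unfolding cluster_def by blast
  have "agree m (t n) x" using agree_trans[OF agree_mono[OF agree_sym[OF st(3)[of n]] n(1)] n(2)] .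
  then have "f (t n) 0 = f x 0" by (rule m[OF st(2) agree_sym])
  moreover have "f (s n) 0 = f x 0" by (rule m[OF st(1) agree_sym[OF n(2)]])
  ultimately show False using neq[of n] by simp
qed

interpretation swap: primitive_const_pair L B \<beta> A \<alpha> ..

lemma shift_equivariant:
  assumes "\<And>x. x \<in> a.X \<Longrightarrow> F x \<in> b.X" and "\<And>x. x \<in> a.X \<Longrightarrow> F (shift 1 x) = shift 1 (F x)"
    and "x \<in> a.X"
  shows "F (shift k x) = shift k (F x)"
proof -
  have nat: "F (shift (int n) x) = shift (int n) (F x)" if "x \<in> a.X" for x n
    using that
  proof (induction n arbitrary: x)
    case (Suc n)
    have "F (shift (int (Suc n)) x) = F (shift (int n) (shift 1 x))" by (simp add: add.commute)
    also have "\<dots> = shift (int n) (F (shift 1 x))" by (rule Suc.IH[OF a.X_shift[OF Suc.prems]])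
    also have "\<dots> = shift (int (Suc n)) (F x)" by (simp add: assms(2) Suc.prems add.commute)
    finally show ?case .
  qed simp
  show ?thesis
  proof (cases "k \<ge> 0")
    case True
    then show ?thesis using nat[OF assms(3), of "nat k"] by simp
  next
    case False
    then have "F x = shift (- k) (F (shift k x))"
      using nat[OF a.X_shift[OF assms(3), of k], of "nat (- k)"] by simp
    then show ?thesis by (metis shift_eq_iff)
  qed
qed

text \<open>Curtis-Hedlund-Lyndon: continuity of \<open>h\<close> and of its inverse
  \<open>g\<close> each yields a radius, and the larger one serves both.\<close>

lemma conjugate_iff_block_conj:
  "topologically_conjugate (subst_topology A \<alpha>) left_shift (subst_topology B \<beta>) left_shift
    \<longleftrightarrow> (\<exists>F r. block_conj r F)"
proof
  assume "topologically_conjugate (subst_topology A \<alpha>) left_shift (subst_topology B \<beta>) left_shift"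
  then obtain h where h: "homeomorphic_map (subst_topology A \<alpha>) (subst_topology B \<beta>) h"
    and comm: "\<And>x. x \<in> a.X \<Longrightarrow> h (shift 1 x) = shift 1 (h x)"
    unfolding topologically_conjugate_def topspace_subst_topology left_shift_eq by blast
  obtain g where g: "homeomorphic_maps (subst_topology A \<alpha>) (subst_topology B \<beta>) h g"
    using h unfolding homeomorphic_map_maps by blast
  have ch: "continuous_map (subst_topology A \<alpha>) (subst_topology B \<beta>) h"
    and cg: "continuous_map (subst_topology B \<beta>) (subst_topology A \<alpha>) g"
    and gh: "\<And>x. x \<in> a.X \<Longrightarrow> g (h x) = x" and hg: "\<And>y. y \<in> b.X \<Longrightarrow> h (g y) = y"
    using g unfolding homeomorphic_maps_def topspace_subst_topology by auto
  have hX: "h x \<in> b.X" if "x \<in> a.X" for x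
    using ch that by (auto simp: continuous_map_def topspace_subst_topology)
  have gX: "g y \<in> a.X" if "y \<in> b.X" for y
    using cg that by (auto simp: continuous_map_def topspace_subst_topology)
  obtain r where r: "\<And>x y. x \<in> a.X \<Longrightarrow> y \<in> a.X \<Longrightarrow> agree r x y \<Longrightarrow> h x 0 = h y 0"
    using local_of_continuous[OF ch] by blast
  obtain r' where r': "\<And>x y. x \<in> b.X \<Longrightarrow> y \<in> b.X \<Longrightarrow> agree r' x y \<Longrightarrow> g x 0 = g y 0"
    using swap.local_of_continuous[OF cg] by blast
  have "block_conj (max r r') h"
    unfolding block_conj_def
  proof (intro conjI ballI impI allI)
    show "bij_betw h a.X b.X"
      by (rule bij_betw_byWitness[of _ g]) (use gh hg hX gX in auto)
    show "h (shift k x) = shift k (h x)" if "x \<in> a.X" for x k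
      by (rule shift_equivariant[of h, OF hX comm that])
    show "h x 0 = h y 0" if "x \<in> a.X" "y \<in> a.X" "agree (max r r') x y" for x y
      by (rule r[OF that(1,2) agree_mono[OF that(3)]]) simp
    show "x 0 = y 0" if "x \<in> a.X" "y \<in> a.X" "agree (max r r') (h x) (h y)" for x y
      using r'[OF hX[OF that(1)] hX[OF that(2)] agree_mono[OF that(3)]] by (simp add: gh that)
  qed
  then show "\<exists>F r. block_conj r F" by blast
next
  assume "\<exists>F r. block_conj r F"
  then obtain F r where F: "block_conj r F" by blast
  define G where "G = inv_into a.X F"
  have FX: "F x \<in> b.X" if "x \<in> a.X" for x using block_conjD(3)[OF F that] .
  have GX: "G y \<in> a.X" and FG: "F (G y) = y" if "y \<in> b.X" for y
    using that block_conjD(1)[OF F] unfolding G_def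
    by (auto simp: bij_betw_def inv_into_into f_inv_into_f)
  have GF: "G (F x) = x" if "x \<in> a.X" for x
    using that block_conjD(1)[OF F] unfolding G_def by (auto simp: bij_betw_def)
  have "continuous_map (subst_topology A \<alpha>) (subst_topology B \<beta>) F"
    unfolding continuous_map_def topspace_subst_topology
  proof (intro conjI allI impI)
    fix U assume "openin (subst_topology B \<beta>) U"
    then have U: "\<exists>m. \<forall>z\<in>b.X. agree m y z \<longrightarrow> z \<in> U" if "y \<in> U" for y
      using that unfolding openin_subst_topology by blast
    show "openin (subst_topology A \<alpha>) {x \<in> a.X. F x \<in> U}"
      unfolding openin_subst_topology
    proof (intro conjI ballI)
      fix x assume x: "x \<in> {x \<in> a.X. F x \<in> U}"
      then obtain m where "\<forall>z\<in>b.X. agree m (F x) z \<longrightarrow> z \<in> U" using U by blast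
      then have "\<forall>z\<in>a.X. agree (m + r) x z \<longrightarrow> z \<in> {x \<in> a.X. F x \<in> U}"
        using x FX block_conj_agree[OF F, of x _ "m + r" m] by blast
      then show "\<exists>m. \<forall>z\<in>a.X. agree m x z \<longrightarrow> z \<in> {x \<in> a.X. F x \<in> U}" ..
    qed blast
  qed (use FX in auto)
  moreover have "continuous_map (subst_topology B \<beta>) (subst_topology A \<alpha>) G"
    unfolding continuous_map_def topspace_subst_topology
  proof (intro conjI allI impI)
    fix U assume "openin (subst_topology A \<alpha>) U"
    then have U: "\<exists>m. \<forall>z\<in>a.X. agree m y z \<longrightarrow> z \<in> U" if "y \<in> U" for y
      using that unfolding openin_subst_topology by blast
    show "openin (subst_topology B \<beta>) {y \<in> b.X. G y \<in> U}"
      unfolding openin_subst_topology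
    proof (intro conjI ballI)
      fix y assume y: "y \<in> {y \<in> b.X. G y \<in> U}"
      then obtain m where m: "\<forall>z\<in>a.X. agree m (G y) z \<longrightarrow> z \<in> U" using U by blast
      have "G z \<in> U" if "z \<in> b.X" "agree (m + r) y z" for z
      proof -
        have "agree m (G y) (G z)"
          by (rule block_conj_agree_inverse[OF F, of _ _ "m + r"]) (use y that GX FG in auto)
        then show ?thesis using m GX that(1) by blast
      qed
      then show "\<exists>m. \<forall>z\<in>b.X. agree m y z \<longrightarrow> z \<in> {y \<in> b.X. G y \<in> U}" by blast
    qed blast
  qed (use GX in auto)
  ultimately have "homeomorphic_maps (subst_topology A \<alpha>) (subst_topology B \<beta>) F G"
    unfolding homeomorphic_maps_def topspace_subst_topology using GF FG by blast
  then have "homeomorphic_map (subst_topology A \<alpha>) (subst_topology B \<beta>) F"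
    unfolding homeomorphic_map_maps by blast
  then show "topologically_conjugate (subst_topology A \<alpha>) left_shift (subst_topology B \<beta>) left_shift"
    unfolding topologically_conjugate_def topspace_subst_topology left_shift_eq
    using block_conjD(2)[OF F] by blast
qed

end

section \<open>Renormalization of conjugacies\<close>

context primitive_const
begin

lemma desubstitute:
  assumes "x \<in> X"
  shows "\<exists>r y. y \<in> X \<and> 0 \<le> r \<and> r < int L \<and> x = shift r (S y)"
  by (rule desubstitution[OF assms, of 1]) auto

text \<open>Applying \<open>S\<close> stretches agreement by a factor of about \<open>L\<close>, the
  source of the contraction of radii. The added \<open>1\<close> accounts for negative positions,
  where \<open>div\<close> rounds away from 0.\<close>

lemma agree_S_expand:
  assumes "agree m x y" and "n div L + 1 \<le> m"
  shows "agree n (S x) (S y)"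
  unfolding agree_def
proof (intro allI impI)
  fix i assume i: "\<bar>i\<bar> \<le> int n"
  have "i div int L \<le> int n div int L" using i L by (intro zdiv_mono1) auto
  moreover have "- (int n div int L) - 1 \<le> i div int L"
  proof -
    have "int n < int L * (int n div int L) + int L"
      using L by (metis add.commute add_strict_left_mono mult_div_mod_eq of_nat_0_less_iff pos_mod_bound zero_less_one less_trans)
    then have "int L * (- (int n div int L) - 1) \<le> i" using i by (simp add: algebra_simps)
    then have "int L * (- (int n div int L) - 1) div int L \<le> i div int L"
      using L by (intro zdiv_mono1) auto
    then show ?thesis using L by simp
  qed
  moreover have "int n div int L + 1 \<le> int m" using assms(2) by (simp flip: of_nat_div)
  ultimately have "\<bar>i div int L\<bar> \<le> int m" by linarith
  with agreeD[OF assms(1)] show "S x i = S y i" by (simp add: subst_seq_def)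
qed

text \<open>The block of the letter at \<open>i\<close> occupies the positions from
  \<open>L * i\<close> to \<open>L * i + L - 1\<close>, none farther from 0 than
  \<open>(\<bar>i\<bar> + 1) * L\<close>.\<close>

lemma image_eq_of_agree_S:
  assumes "agree n (S x) (S y)" and "(\<bar>i\<bar> + 1) * int L \<le> int n"
    and "\<And>i. x i \<in> A" and "\<And>i. y i \<in> A"
  shows "\<alpha> (x i) = \<alpha> (y i)"
proof -
  have "window (S x) (int L * i) (L * 1) = window (S y) (int L * i) (L * 1)"
    unfolding window_eq_iff
  proof (intro allI impI)
    fix k assume "k < L * 1"
    then have k: "int k < int L" by simp
    have "\<bar>int L * i + int k\<bar> \<le> int L * \<bar>i\<bar> + int k"
      by (rule order_trans[OF abs_triangle_ineq]) (simp add: abs_mult)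
    also have "\<dots> \<le> (\<bar>i\<bar> + 1) * int L" using k by (simp add: algebra_simps)
    finally show "S x (int L * i + int k) = S y (int L * i + int k)"
      using assms(1,2) by (intro agreeD[of n]) simp_all
  qed
  then show ?thesis
    unfolding S_window[OF assms(3)] S_window[OF assms(4)] by (simp add: window_def subst_word_def)
qed

end

context primitive_const_pair
begin

lemma renormalize:
  assumes F: "block_conj r F" and Ma: "a.injectivity_radius M" and Mb: "b.injectivity_radius M"
  obtains F' k where "block_conj (M + 3 + r div 2) F'" and "0 \<le> k" and "k < int L"
    and "\<And>x. x \<in> a.X \<Longrightarrow> F (a.S x) = shift k (b.S (F' x))"
proof -
  note FX = block_conjD(3)[OF F] and Fshift = block_conjD(2)[OF F]
  have SX: "a.S x \<in> a.X" if "x \<in> a.X" for x using a.X_Sn[OF that, of 1] by simp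
  obtain x0 where x0: "x0 \<in> a.X" using a.X_nonempty by blast
  obtain k y0 where y0: "y0 \<in> b.X" and k: "0 \<le> k" "k < int L" and eq0: "F (a.S x0) = shift k (b.S y0)"
    using b.desubstitute[OF FX[OF SX[OF x0]]] by blast
  \<comment> \<open>The offset \<open>k\<close> found for the single point \<open>x0\<close> works
    for all points: shifting \<open>x0\<close> by \<open>q\<close> shifts both images by
    \<open>L * q\<close> and leaves \<open>k\<close> unchanged, and the orbit of \<open>x0\<close>
    is dense.\<close>
  have "\<exists>y\<in>b.X. F (a.S x) = shift k (b.S y)" if x: "x \<in> a.X" for x
  proof -
    obtain q where q: "\<And>m. agree m (shift (q m) x0) x"
    proof -
      have "\<exists>q. agree m (shift q x0) x" for m using a.orbit_dense[OF x0 x] by blast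
      then show thesis using that by metis
    qed
    obtain y where y: "y \<in> b.X" "cluster (\<lambda>m. shift (q m) y0) y"
      by (rule b.X_cluster_exists[of "\<lambda>m. shift (q m) y0"]) (auto simp: b.X_shift y0)
    have "F (a.S x) = shift k (b.S y)"
    proof
      fix i
      let ?m = "nat \<bar>i\<bar> + nat \<bar>k\<bar>"
      obtain l where l: "l \<ge> ?m + r" "agree ?m (shift (q l) y0) y" using y(2) unfolding cluster_def by blast
      have "agree l (a.S x) (a.S (shift (q l) x0))" by (rule a.agree_S[OF agree_sym[OF q]])
      then have "agree ?m (F (a.S x)) (F (a.S (shift (q l) x0)))"
        using l(1) x x0 by (intro block_conj_agree[OF F]) (auto intro: SX a.X_shift)
      then have "F (a.S x) i = F (a.S (shift (q l) x0)) i" by (rule agreeD) simp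
      also have "\<dots> = b.S (shift (q l) y0) (i + k)"
        by (simp add: a.S_shift b.S_shift Fshift SX x0 eq0 shift_apply algebra_simps)
      also have "\<dots> = b.S y (i + k)" by (rule agreeD[OF b.agree_S[OF l(2)]]) simp
      finally show "F (a.S x) i = shift k (b.S y) i" by (simp add: shift_apply)
    qed
    with y(1) show ?thesis by blast
  qed
  then obtain F' where F'X: "\<And>x. x \<in> a.X \<Longrightarrow> F' x \<in> b.X"
    and F': "\<And>x. x \<in> a.X \<Longrightarrow> F (a.S x) = shift k (b.S (F' x))"
    by metis
  have F'eq: "y = F' x" if "x \<in> a.X" "y \<in> b.X" "F (a.S x) = shift k (b.S y)" for x y
  proof -
    have "b.S y = b.S (F' x)" using that(3) F'[OF that(1)] by (metis shift_eq_iff)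
    then show ?thesis using b.S_inj that(2) F'X[OF that(1)] by (auto dest: inj_onD)
  qed
  have Finj: "x = y" if "F x = F y" "x \<in> a.X" "y \<in> a.X" for x y
    using that block_conjD(1)[OF F] by (auto simp: bij_betw_def dest: inj_onD)
  have F'A: "F' x i \<in> B" if "x \<in> a.X" for x i using b.X_A[OF F'X[OF that]] .
  have kL: "nat \<bar>k\<bar> \<le> L" "nat \<bar>- k\<bar> \<le> L" using k by linarith+
  \<comment> \<open>Agreement of \<open>x\<close> and \<open>y\<close> up to
    \<open>M + 3 + r div 2\<close> gives agreement of their images up to
    \<open>(M + 2) * L + r\<close>. Applying \<open>F\<close> costs \<open>r\<close> and undoing the
    shift by \<open>k\<close> at most \<open>L\<close>. What remains, \<open>(M + 1) * L\<close>,
    fixes the images of all letters up to distance \<open>M\<close>.\<close>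
  have rad: "((M + 2) * L + r) div L + 1 \<le> M + 3 + r div 2"
  proof -
    have "r div L \<le> r div 2" using a.L by (intro div_le_mono2) auto
    moreover have "((M + 2) * L + r) div L = M + 2 + r div L" using a.L by (intro div_mult_self3) auto
    ultimately show ?thesis by simp
  qed
  have "block_conj (M + 3 + r div 2) F'"
    unfolding block_conj_def
  proof (intro conjI ballI impI allI)
    show "F' (shift l x) = shift l (F' x)" if "x \<in> a.X" for x l
      by (rule F'eq[symmetric])
        (simp_all add: that a.X_shift b.X_shift F'X a.S_shift b.S_shift Fshift SX F' add.commute)
    show "bij_betw F' a.X b.X"
      unfolding bij_betw_def
    proof
      show "inj_on F' a.X"
      proof (rule inj_onI)
        fix x y assume x: "x \<in> a.X" and y: "y \<in> a.X" and "F' x = F' y"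
        then have "F (a.S x) = F (a.S y)" using F'[OF x] F'[OF y] by simp
        then have "a.S x = a.S y" using x y by (intro Finj SX)
        then show "x = y" using a.S_inj x y by (auto dest: inj_onD)
      qed
      show "F' ` a.X = b.X"
      proof
        show "b.X \<subseteq> F' ` a.X"
        proof
          fix y assume y: "y \<in> b.X"
          have "shift k (b.S y) \<in> b.X" using b.X_shift[OF b.X_Sn[OF y, of 1]] by simp
          then have "shift k (b.S y) \<in> F ` a.X" using block_conjD(1)[OF F] by (simp add: bij_betw_def)
          then obtain x where x: "x \<in> a.X" "F x = shift k (b.S y)" by auto
          obtain i u where u: "u \<in> a.X" and i: "0 \<le> i" "i < int L" and xu: "x = shift i (a.S u)"
            using a.desubstitute[OF x(1)] by blast
          have eq: "shift k (b.S y) = shift (i + k) (b.S (F' u))"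
            using x(2) by (simp add: xu Fshift SX u F')
          then have "b.S y = shift i (b.S (F' u))"
            by (metis add.commute shift_eq_iff shift_shift)
          \<comment> \<open>Recognizability excludes a nonzero offset \<open>i\<close> below
            \<open>L\<close>, so the preimage \<open>x\<close> begins exactly at a block.\<close>
          then have "(b.S ^^ 1) y = shift i ((b.S ^^ 1) (F' u))" by simp
          then have "i \<in> b.overlaps 1" unfolding b.overlaps_def using y F'X[OF u] by blast
          then have "int L ^ 1 dvd i" by (rule b.overlaps_dvd)
          then have "i = 0" using i zdvd_imp_le[of "int L" i] by fastforce
          then have "y = F' u" using eq by (intro F'eq u y) (simp add: F' u)
          then show "y \<in> F' ` a.X" using u by blast
        qed
      qed (use F'X in auto)
    qed
    show "F' x 0 = F' y 0" if x: "x \<in> a.X" and y: "y \<in> a.X" and xy: "agree (M + 3 + r div 2) x y" for x y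
    proof -
      let ?n = "(M + 2) * L"
      have "agree (?n + r) (a.S x) (a.S y)"
        by (rule a.agree_S_expand[OF xy rad])
      then have "agree ?n (F (a.S x)) (F (a.S y))"
        using x y by (intro block_conj_agree[OF F]) (auto intro: SX)
      then have "agree ?n (shift k (b.S (F' x))) (shift k (b.S (F' y)))" by (simp add: F' x y)
      then have "agree ((M + 1) * L) (shift (- k) (shift k (b.S (F' x)))) (shift (- k) (shift k (b.S (F' y))))"
        by (rule agree_shift) (use kL in \<open>simp add: algebra_simps\<close>)
      then have ag: "agree ((M + 1) * L) (b.S (F' x)) (b.S (F' y))" by simp
      have "\<beta> (F' x i) = \<beta> (F' y i)" if "\<bar>i\<bar> \<le> int M" for i
      proof (rule b.image_eq_of_agree_S[OF ag])
        have "(\<bar>i\<bar> + 1) * int L \<le> (int M + 1) * int L" using that by (intro mult_right_mono) auto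
        then show "(\<bar>i\<bar> + 1) * int L \<le> int ((M + 1) * L)" by (simp add: algebra_simps)
      qed (use F'A x y in auto)
      then show ?thesis using Mb F'X[OF x] F'X[OF y] unfolding b.injectivity_radius_def by blast
    qed
    \<comment> \<open>The losses come in the opposite order, at most \<open>L\<close> for the shift
      and then \<open>r\<close> for inverting \<open>F\<close>; the same starting radius
      suffices.\<close>
    show "x 0 = y 0" if x: "x \<in> a.X" and y: "y \<in> a.X" and xy: "agree (M + 3 + r div 2) (F' x) (F' y)" for x y
    proof -
      let ?n = "(M + 2) * L + r"
      have "agree ?n (b.S (F' x)) (b.S (F' y))"
        by (rule b.agree_S_expand[OF xy rad])
      then have "agree ((M + 1) * L + r) (shift k (b.S (F' x))) (shift k (b.S (F' y)))"
        by (rule agree_shift) (use kL in \<open>simp add: algebra_simps\<close>)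
      then have "agree ((M + 1) * L + r) (F (a.S x)) (F (a.S y))" by (simp add: F' x y)
      then have ag: "agree ((M + 1) * L) (a.S x) (a.S y)"
        using x y by (intro block_conj_agree_inverse[OF F]) (auto intro: SX)
      have "\<alpha> (x i) = \<alpha> (y i)" if "\<bar>i\<bar> \<le> int M" for i
      proof (rule a.image_eq_of_agree_S[OF ag])
        have "(\<bar>i\<bar> + 1) * int L \<le> (int M + 1) * int L" using that by (intro mult_right_mono) auto
        then show "(\<bar>i\<bar> + 1) * int L \<le> int ((M + 1) * L)" by (simp add: algebra_simps)
      qed (use a.X_A x y in auto)
      then show ?thesis using Ma x y unfolding a.injectivity_radius_def by blast
    qed
  qed
  then show thesis using k F' by (rule that)
qed

text \<open>Renormalization strictly lowers the radius as long as \<open>r > 2 * M + 6\<close>,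
  because then \<open>M + 3 + r div 2 < r\<close>. The conjugacy obtained is in general a different
  one.\<close>

lemma block_conj_bounded:
  assumes "block_conj r F" and "a.injectivity_radius M" and "b.injectivity_radius M"
  shows "\<exists>F. block_conj (2 * M + 6) F"
  using assms(1)
proof (induction r arbitrary: F rule: less_induct)
  case (less r)
  show ?case
  proof (cases "r \<le> 2 * M + 6")
    case True
    then show ?thesis using block_conj_mono[OF less.prems] by blast
  next
    case False
    obtain F' where F': "block_conj (M + 3 + r div 2) F'"
      using renormalize[OF less.prems assms(2,3)] by blast
    show ?thesis by (rule less.IH[OF _ F']) (use False in linarith)
  qed
qed

lemma renormalization_sequence:
  assumes "block_conj r F" and "a.injectivity_radius M" and "b.injectivity_radius M"
  obtains G k where "\<And>n. block_conj (2 * M + 6) (G n)" and "\<And>n. 0 \<le> k n" and "\<And>n. k n < int L"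
    and "\<And>n x. x \<in> a.X \<Longrightarrow> G n (a.S x) = shift (k n) (b.S (G (Suc n) x))"
proof -
  let ?next = "\<lambda>F k F'. 0 \<le> k \<and> k < int L \<and> (\<forall>x\<in>a.X. F (a.S x) = shift k (b.S (F' x)))"
  have "\<exists>G. \<forall>n. block_conj (2 * M + 6) (G n) \<and> (\<exists>k. ?next (G n) k (G (Suc n)))"
  proof (rule dependent_nat_choice)
    show "\<exists>F. block_conj (2 * M + 6) F" by (rule block_conj_bounded[OF assms])
    fix F and n :: nat assume "block_conj (2 * M + 6) F"
    then obtain F' k where F': "block_conj (M + 3 + (2 * M + 6) div 2) F'" and k: "?next F k F'"
      using renormalize[OF _ assms(2,3)] by metis
    have "block_conj (2 * M + 6) F'" by (rule block_conj_mono[OF F']) simp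
    with k show "\<exists>F'. block_conj (2 * M + 6) F' \<and> (\<exists>k. ?next F k F')" by blast
  qed
  then show thesis using that by metis
qed

lemma renormalization_iterate:
  assumes G: "\<And>n x. x \<in> a.X \<Longrightarrow> G n (a.S x) = shift (k n) (b.S (G (Suc n) x))"
    and k: "\<And>n. 0 \<le> k n" "\<And>n. k n < int L"
  shows "\<exists>K<L ^ m. \<forall>x\<in>a.X. G n ((a.S ^^ m) x) = shift (int K) ((b.S ^^ m) (G (n + m) x))"
proof (induction m arbitrary: n)
  case 0
  show ?case by simp
next
  case (Suc m)
  obtain K where K: "K < L ^ m"
    and eq: "\<And>x. x \<in> a.X \<Longrightarrow> G (Suc n) ((a.S ^^ m) x) = shift (int K) ((b.S ^^ m) (G (Suc n + m) x))"
    using Suc.IH by blast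
  \<comment> \<open>The offsets \<open>k n\<close>, \<open>k (Suc n)\<close> and so on are the base
    \<open>L\<close> digits of the total offset, the lowest first; hence it stays below
    \<open>L ^ Suc m\<close>.\<close>
  let ?K = "nat (k n) + L * K"
  have "nat (k n) < L" using k[of n] by (simp add: nat_less_iff)
  moreover have "L * K + L \<le> L * L ^ m" using mult_le_mono2[of "Suc K" "L ^ m" L] K by simp
  ultimately have "?K < L ^ Suc m" by simp
  moreover have "G n ((a.S ^^ Suc m) x) = shift (int ?K) ((b.S ^^ Suc m) (G (n + Suc m) x))"
    if x: "x \<in> a.X" for x
    using k[of n] by (simp add: G[OF a.X_Sn[OF x]] eq[OF x] b.S_shift)
  ultimately show ?case by blast
qed

end

section \<open>Finite checks\<close>

text \<open>Table lookup with default \<open>d\<close>, where later entries override earlier ones;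
  written as a \<open>fold\<close> so that \<open>computable_fold\<close> applies.\<close>

definition assoc :: "'b \<Rightarrow> ('a \<times> 'b) list \<Rightarrow> 'a \<Rightarrow> 'b" where
  "assoc d ps k = fold (\<lambda>p r. if fst p = k then snd p else r) ps d"

definition factors :: "nat \<Rightarrow> 'a list \<Rightarrow> 'a list list" where
  "factors n w = map (\<lambda>i. take n (drop i w)) [0..<Suc (length w) - n]"

definition block :: "nat \<Rightarrow> ('a list \<Rightarrow> 'b) \<Rightarrow> 'a list \<Rightarrow> 'b list" where
  "block n f w = map f (factors n w)"

definition lang :: "('a \<times> 'a list) list \<Rightarrow> nat \<Rightarrow> nat \<Rightarrow> 'a list list" where
  "lang T n N = concat (map (\<lambda>p. factors n ((subst_word (assoc [] T) ^^ N) [fst p])) T)"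

text \<open>Since \<open>n \<le> N \<le> L ^ N\<close>, the factors of length \<open>n\<close> at depth \<open>N + 1\<close> depend only on those at
  depth \<open>N\<close>; once nothing new appears, the language in length \<open>n\<close> is complete.\<close>

definition stable :: "('a \<times> 'a list) list \<Rightarrow> nat \<Rightarrow> nat \<Rightarrow> bool" where
  "stable T n N \<longleftrightarrow> 1 \<le> N \<and> n \<le> N \<and> (\<forall>w\<in>set (lang T n (Suc N)). w \<in> set (lang T n N))"

lemma assoc_map: "k \<in> set ks \<Longrightarrow> assoc d (map (\<lambda>k. (k, f k)) ks) k = f k"
  unfolding assoc_def by (induction ks rule: rev_induct) auto

lemma set_factors: "set (factors n w) = {v. sublist v w \<and> length v = n}"
proof
  show "set (factors n w) \<subseteq> {v. sublist v w \<and> length v = n}"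
    by (auto simp: factors_def sublist_iff_take_drop intro!: exI)
  show "{v. sublist v w \<and> length v = n} \<subseteq> set (factors n w)"
  proof
    fix v assume "v \<in> {v. sublist v w \<and> length v = n}"
    then obtain j where "j + n \<le> length w" "v = take n (drop j w)"
      by (auto simp: sublist_iff_take_drop)
    then show "v \<in> set (factors n w)" by (auto simp: factors_def)
  qed
qed

lemma block_window:
  "block n f (window x i l) = window (\<lambda>j. f (window x j n)) i (Suc l - n)"
  unfolding block_def factors_def
  by (rule nth_equalityI) (auto simp: take_drop_window)

definition block_map :: "nat \<Rightarrow> ('a list \<Rightarrow> 'b) \<Rightarrow> (int \<Rightarrow> 'a) \<Rightarrow> (int \<Rightarrow> 'b)" where
  "block_map R f x = (\<lambda>j. f (window x (j - int R) (2 * R + 1)))"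

lemma block_window_map:
  "block (2 * R + 1) f (window x i l) = window (block_map R f x) (i + int R) (l - 2 * R)"
  unfolding block_window by (auto simp: window_def block_map_def algebra_simps)

lemma block_map_shift: "block_map R f (shift k x) = shift k (block_map R f x)"
  by (simp add: block_map_def fun_eq_iff window_shift shift_apply algebra_simps)

context primitive_const
begin

section \<open>Factors by depth and completeness of the language\<close>

definition facs :: "nat \<Rightarrow> nat \<Rightarrow> 'a list set" where
  "facs n N = {w. length w = n \<and> (\<exists>a\<in>A. sublist w (sw N [a]))}"

text \<open>By primitivity \<open>a\<close> occurs in \<open>sw p [a]\<close>, hence in the image of
  some letter \<open>b\<close>; then \<open>sw N [a]\<close> is a factor of
  \<open>sw (Suc N) [b]\<close>.\<close>

lemma facs_mono_Suc: "facs n N \<subseteq> facs n (Suc N)"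
proof
  fix w assume "w \<in> facs n N"
  then obtain a where a: "a \<in> A" "sublist w (sw N [a])" and n: "length w = n" by (auto simp: facs_def)
  obtain p where p: "p \<ge> 1" "\<And>a b. a \<in> A \<Longrightarrow> b \<in> A \<Longrightarrow> a \<in> set (sw p [b])"
    using prim_obtain by blast
  have "sw p [a] = subst_word \<alpha> (sw (p - 1) [a])" using p(1) by (cases p) simp_all
  then have "a \<in> set (subst_word \<alpha> (sw (p - 1) [a]))" using p(2)[OF a(1) a(1)] by simp
  then obtain b where b: "b \<in> set (sw (p - 1) [a])" "a \<in> set (\<alpha> b)" by (auto simp: subst_word_def)
  then have "b \<in> A" using sw_lists[of "[a]" "p - 1"] a(1) by (auto simp: in_lists_conv_set)
  have "sublist [a] (\<alpha> b)" using b(2) by (rule sublist_singleton)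
  then have "sublist (sw N [a]) (sw N (\<alpha> b))" by (rule sublist_sw)
  moreover have "sw N (\<alpha> b) = sw (Suc N) [b]" by (simp add: subst_word_def funpow_swap1)
  ultimately show "w \<in> facs n (Suc N)"
    unfolding facs_def using n \<open>b \<in> A\<close> sublist_order.order_trans[OF a(2)] by auto
qed

lemma facs_mono: "N \<le> N' \<Longrightarrow> facs n N \<subseteq> facs n N'"
  by (rule lift_Suc_mono_le[of "facs n", OF facs_mono_Suc])

text \<open>A nonempty factor of length \<open>n\<close> of \<open>subst_word \<alpha> v\<close> is
  covered by the images of \<open>n\<close> consecutive letters of \<open>v\<close>. These form a
  word of length \<open>n\<close>, which by assumption already occurs one depth earlier.\<close>

lemma facs_stable_step:
  assumes "n \<le> N" and sub: "facs n (Suc N) \<subseteq> facs n N"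
  shows "facs n (Suc (Suc N)) \<subseteq> facs n (Suc N)"
proof
  fix w assume "w \<in> facs n (Suc (Suc N))"
  then obtain a where a: "a \<in> A" "sublist w (subst_word \<alpha> (sw (Suc N) [a]))" and n: "length w = n"
    by (auto simp: facs_def)
  define v where "v = sw (Suc N) [a]"
  have v: "v \<in> lists A" unfolding v_def using a(1) by (intro sw_lists) simp
  \<comment> \<open>Together with \<open>n \<le> N\<close> this makes \<open>v\<close> long enough
    to contain factors of length \<open>n\<close>.\<close>
  have "Suc N < L ^ Suc N" by (rule power_gt_expt) (use L in simp)
  then have len_v: "n \<le> length v" unfolding v_def using a(1) assms(1) by (simp add: length_sw del: funpow.simps)
  obtain t where t: "t + n \<le> L * length v" "w = take n (drop t (subst_word \<alpha> v))"
    using a(2) unfolding v_def[symmetric] sublist_iff_take_drop by (auto simp: n length_subst_word v)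
  \<comment> \<open>The letter whose image contains position \<open>t\<close>, moved left where
    necessary so that \<open>n\<close> letters still fit into \<open>v\<close>.\<close>
  define s where "s = min (t div L) (length v - n)"
  define u where "u = take n (drop s v)"
  have s: "s + n \<le> length v" using len_v by (simp add: s_def)
  have u: "length u = n" "sublist u v" using s
    by (auto simp: u_def sublist_iff_take_drop intro!: exI[of _ s])
  have "w \<in> facs n (Suc N)"
  proof (cases "n = 0")
    case True
    then show ?thesis using n a(1) by (auto simp: facs_def)
  next
    case False
    have "L * s \<le> L * (t div L)" by (intro mult_le_mono2) (simp add: s_def)
    then have low: "L * s \<le> t" using times_div_less_eq_dividend[of L t] by linarith
    have high: "t + n \<le> L * s + L * n"
    proof (cases "t div L \<le> length v - n")
      case True
      have "s = t div L" using True by (simp add: s_def)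
      then have "t < L * s + L" using L dividend_less_times_div[of L t] by simp
      moreover have "L - 1 \<le> (L - 1) * n" using mult_le_mono2[of 1 n "L - 1"] \<open>n \<noteq> 0\<close> by linarith
      moreover have "(L - 1) * n + n = L * n" using L by (cases L) simp_all
      ultimately show ?thesis using L by linarith
    next
      case False
      then have "s = length v - n" by (simp add: s_def)
      then have "L * s + L * n = L * length v" using len_v by (simp flip: distrib_left)
      then show ?thesis using t(1) by simp
    qed
    have du: "subst_word \<alpha> u = take (L * n) (drop (L * s) (subst_word \<alpha> v))"
    proof -
      have "drop (L * s) (subst_word \<alpha> v) = subst_word \<alpha> (drop s v)"
        using drop_sw[OF v, of s 1] s by simp
      moreover have "drop s v \<in> lists A" using v by (auto simp: in_lists_conv_set dest: in_set_dropD)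
      then have "take (L * n) (subst_word \<alpha> (drop s v)) = subst_word \<alpha> (take n (drop s v))"
        using take_sw[of "drop s v" n 1] s by simp
      ultimately show ?thesis by (simp add: u_def)
    qed
    have "w = take n (drop (t - L * s) (subst_word \<alpha> u))"
      unfolding t(2) du using low high by (simp add: drop_take min_def)
    then have "sublist w (subst_word \<alpha> u)"
      by (metis sublist_drop sublist_order.order_trans sublist_take)
    moreover have "u \<in> facs n (Suc N)" unfolding facs_def using u a(1) by (auto simp: v_def)
    then obtain b where b: "b \<in> A" "sublist u (sw N [b])" using sub by (auto simp: facs_def)
    ultimately have "sublist w (sw (Suc N) [b])"
      using sublist_sw[OF b(2), of 1] by (auto intro: sublist_order.order_trans)
    then show ?thesis using b(1) n by (auto simp: facs_def)
  qed
  then show "w \<in> facs n (Suc N)" .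
qed

lemma facs_stable:
  assumes "1 \<le> N" and "n \<le> N" and "facs n (Suc N) \<subseteq> facs n N"
  shows "facs n N = {w \<in> Lang. length w = n}"
proof -
  have step: "facs n (Suc (N + k)) \<subseteq> facs n (N + k)" for k
  proof (induction k)
    case (Suc k)
    then show ?case using facs_stable_step[of n "N + k"] assms(2) by simp
  qed (simp add: assms(3))
  have above: "facs n (N + k) \<subseteq> facs n N" for k
    by (induction k) (use step in auto)
  have "facs n k \<subseteq> facs n N" for k
    using facs_mono[of k N n] above[of "k - N"] by (cases "k \<le> N") auto
  then show ?thesis using assms(1) unfolding facs_def subst_language_def by blast
qed

lemma finite_Lang_length: "finite {w \<in> Lang. length w = n}"
  by (rule finite_subset[OF _ finite_lists_length_eq[OF finite_A, of n]])
    (use Lang_lists in \<open>auto simp: in_lists_conv_set\<close>)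

lemma facs_eventually: "\<forall>\<^sub>F N in sequentially. facs n N = {w \<in> Lang. length w = n}"
proof -
  have "\<forall>\<^sub>F N in sequentially. w \<in> facs n N" if w: "w \<in> {w \<in> Lang. length w = n}" for w
  proof -
    obtain k where "w \<in> facs n k" using w unfolding facs_def subst_language_def by blast
    then show ?thesis unfolding eventually_sequentially using facs_mono by blast
  qed
  then have "\<forall>\<^sub>F N in sequentially. \<forall>w\<in>{w \<in> Lang. length w = n}. w \<in> facs n N"
    by (intro eventually_ball_finite finite_Lang_length ballI)
  then show ?thesis
    using eventually_ge_at_top[of 1]
  proof eventually_elim
    case (elim N)
    moreover have "facs n N \<subseteq> {w \<in> Lang. length w = n}"
      using elim(2) unfolding facs_def subst_language_def by blast
    ultimately show ?case by blast
  qed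
qed

text \<open>Every word of the language occurs in every point, by \<open>recurrence\<close>. This
  turns statements on the windows of all points at a fixed position into statements on finitely many
  words.\<close>

lemma Lang_eq_windows: "{w \<in> Lang. length w = n} = (\<lambda>x. window x i n) ` X"
proof
  show "{w \<in> Lang. length w = n} \<subseteq> (\<lambda>x. window x i n) ` X"
  proof
    fix w assume w: "w \<in> {w \<in> Lang. length w = n}"
    obtain x where x: "x \<in> X" using X_nonempty by blast
    obtain j where "window x j n = w" using recurrence[of w x] w x by auto
    then show "w \<in> (\<lambda>x. window x i n) ` X"
      using X_shift[OF x, of "j - i"] by (intro image_eqI[of _ _ "shift (j - i) x"]) (simp_all add: window_shift)
  qed
qed (auto simp: X_window)

section \<open>Tables and tests on words\<close>

definition is_table :: "('a \<times> 'a list) list \<Rightarrow> bool" where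
  "is_table T \<longleftrightarrow> fst ` set T = A \<and> (\<forall>a\<in>A. assoc [] T a = \<alpha> a)"

lemma table_sw:
  assumes T: "is_table T" and w: "w \<in> lists A"
  shows "(subst_word (assoc [] T) ^^ n) w = sw n w"
proof (induction n)
  case (Suc n)
  have "map (assoc [] T) (sw n w) = map \<alpha> (sw n w)"
    using sw_lists[OF w] T by (auto simp: is_table_def in_lists_conv_set)
  then have "subst_word (assoc [] T) (sw n w) = subst_word \<alpha> (sw n w)"
    by (simp only: subst_word_def[of "assoc [] T" "sw n w"] subst_word_def[of \<alpha> "sw n w"])
  then show ?case by (simp add: Suc)
qed simp

lemma set_lang:
  assumes "is_table T"
  shows "set (lang T n N) = facs n N"
proof -
  have T: "fst ` set T = A" using assms by (simp add: is_table_def)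
  have "set (lang T n N) = (\<Union>a\<in>fst ` set T. set (factors n ((subst_word (assoc [] T) ^^ N) [a])))"
    by (simp add: lang_def)
  also have "\<dots> = facs n N"
    unfolding T facs_def by (auto simp: set_factors table_sw[OF assms])
  finally show ?thesis .
qed

lemma stable_lang:
  assumes "is_table T" and "stable T n N"
  shows "set (lang T n N) = {w \<in> Lang. length w = n}"
  using assms(2) facs_stable[of N n] unfolding stable_def set_lang[OF assms(1)] by blast

lemma stable_ball:
  assumes "is_table T" and "stable T n N"
  shows "(\<forall>w\<in>set (lang T n N). P w) \<longleftrightarrow> (\<forall>x\<in>X. P (window x i n))"
  unfolding stable_lang[OF assms] Lang_eq_windows[of n i] by blast

lemma stable_eventually:
  assumes "is_table T"
  shows "\<forall>\<^sub>F N in sequentially. stable T n N"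
  using eventually_ge_at_top[of "n + 1"] facs_eventually[of n]
    facs_eventually[of n, folded eventually_sequentially_Suc[of "\<lambda>N. facs n N = {w \<in> Lang. length w = n}"]]
  by eventually_elim (auto simp: stable_def set_lang[OF assms])

end

text \<open>The letter at position \<open>c\<close> is compared as a list, so that the test is built
  from \<open>take\<close> and \<open>drop\<close>. It serves both for images under the substitution
  and for images under a block map.\<close>

definition separating :: "('a list \<Rightarrow> 'b list) \<Rightarrow> nat \<Rightarrow> 'a list list \<Rightarrow> bool" where
  "separating g c W \<longleftrightarrow>
    (\<forall>w\<in>set W. \<forall>w'\<in>set W. g w = g w' \<longrightarrow> take 1 (drop c w) = take 1 (drop c w'))"

lemma take_1_drop_window: "c < n \<Longrightarrow> take 1 (drop c (window x i n)) = [x (i + int c)]"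
  by (simp add: take_drop_window) (simp add: window_def)

context primitive_const
begin

lemma separating_images:
  assumes T: "is_table T" and st: "stable T (2 * M + 1) N"
  shows "separating (map (assoc [] T)) M (lang T (2 * M + 1) N) \<longleftrightarrow> injectivity_radius M"
proof -
  have map: "map (assoc [] T) (window x i n) = map \<alpha> (window x i n)" if "x \<in> X" for x i n
    using T X_A[OF that] by (auto simp: is_table_def window_def)
  have eq: "map \<alpha> (window x (- int M) (2 * M + 1)) = map \<alpha> (window y (- int M) (2 * M + 1))
      \<longleftrightarrow> (\<forall>i. \<bar>i\<bar> \<le> int M \<longrightarrow> \<alpha> (x i) = \<alpha> (y i))" for x y
  proof -
    have "map \<alpha> (window z i n) = window (\<lambda>i. \<alpha> (z i)) i n" for z i n by (simp add: window_def)
    then show ?thesis by (simp only: agree_iff_window[symmetric] agree_def)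
  qed
  have img: "map (assoc [] T) (window x (- int M) (2 * M + 1)) = map (assoc [] T) (window y (- int M) (2 * M + 1))
      \<longleftrightarrow> (\<forall>i. \<bar>i\<bar> \<le> int M \<longrightarrow> \<alpha> (x i) = \<alpha> (y i))" if "x \<in> X" "y \<in> X" for x y
    unfolding map[OF that(1)] map[OF that(2)] by (rule eq)
  have mid: "take 1 (drop M (window x (- int M) (2 * M + 1))) = [x 0]" for x :: "int \<Rightarrow> 'a"
    by (subst take_1_drop_window) simp_all
  show ?thesis
    unfolding separating_def stable_ball[OF T st, where i = "- int M"] mid injectivity_radius_def
    by (intro ball_cong refl) (simp only: img list.inject simp_thms)
qed

text \<open>The block image on positions \<open>- R\<close> to \<open>R\<close> depends on
  \<open>x\<close> from \<open>- 2 * R\<close> to \<open>2 * R\<close>, whence the length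
  \<open>4 * R + 1\<close> and the centre \<open>2 * R\<close>.\<close>

lemma separating_block:
  assumes T: "is_table T" and st: "stable T (4 * R + 1) N"
  shows "separating (block (2 * R + 1) f) (2 * R) (lang T (4 * R + 1) N) \<longleftrightarrow>
    (\<forall>x\<in>X. \<forall>y\<in>X. agree R (block_map R f x) (block_map R f y) \<longrightarrow> x 0 = y 0)"
proof -
  have len: "4 * R + 1 - 2 * R = 2 * R + 1" by simp
  have blk: "block (2 * R + 1) f (window x (- 2 * int R) (4 * R + 1))
      = window (block_map R f x) (- int R) (2 * R + 1)" for x
    unfolding block_window_map len by simp
  have mid: "take 1 (drop (2 * R) (window x (- 2 * int R) (4 * R + 1))) = [x 0]" for x :: "int \<Rightarrow> 'a"
    by (subst take_1_drop_window) simp_all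
  show ?thesis
    unfolding separating_def stable_ball[OF T st, where i = "- 2 * int R"] blk mid agree_iff_window
    by simp
qed

end

definition radius :: "nat \<Rightarrow> nat" where
  "radius M = 2 * M + 6"

text \<open>Intended for \<open>Q = L ^ m\<close>. With \<open>w\<close> placed at the positions \<open>-R, \<dots>, R + 1\<close>, the block map turns
  \<open>w\<close> into the letters at \<open>0, 1\<close>, and the offset \<open>R * Q - R\<close> marks position \<open>0\<close> in the block image of
  \<open>\<alpha> ^ m (w)\<close>. The condition is the identity \<open>F \<circ> \<alpha> ^ m = \<sigma> ^ K \<circ> \<beta> ^ m \<circ> F\<close> read on one block.\<close>

definition renormalizable ::
  "('a \<times> 'a list) list \<Rightarrow> ('b \<times> 'b list) list \<Rightarrow> nat \<Rightarrow> nat \<Rightarrow> nat \<Rightarrow> ('a list \<Rightarrow> 'b) \<Rightarrow> nat \<Rightarrow> nat \<Rightarrow> bool" where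
  "renormalizable T U R N Q f m K \<longleftrightarrow> (\<forall>w\<in>set (lang T (2 * R + 2) N).
     block (2 * R + 1) f w \<in> set (lang U 2 N) \<and>
     take Q (drop (R * Q - R) (block (2 * R + 1) f ((subst_word (assoc [] T) ^^ m) w))) =
     take Q (drop K ((subst_word (assoc [] U) ^^ m) (block (2 * R + 1) f w))))"

context primitive_const_pair
begin

lemma renormalizable_iff:
  assumes T: "a.is_table T" and U: "b.is_table U" and stT: "stable T (2 * R + 2) N" and stU: "stable U 2 N"
    and K: "K < L ^ m"
  shows "renormalizable T U R N (L ^ m) f m K \<longleftrightarrow>
    (\<forall>x\<in>a.X. window (block_map R f x) 0 2 \<in> b.Lang) \<and>
    (\<forall>x\<in>a.X. window (block_map R f ((a.S ^^ m) x)) 0 (L ^ m) = window ((b.S ^^ m) (block_map R f x)) (int K) (L ^ m))"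
    (is "?l \<longleftrightarrow> ?r1 \<and> ?r2")
proof -
  let ?Q = "L ^ m" and ?F = "block_map R f"
  have Q: "?Q \<ge> 1" using a.L by simp
  have len: "2 * R + 2 - 2 * R = 2" by simp
  have blk: "block (2 * R + 1) f (window x (- int R) (2 * R + 2)) = window (?F x) 0 2" for x
    unfolding block_window_map len by simp
  have in_lang: "window (?F x) 0 2 \<in> set (lang U 2 N) \<longleftrightarrow> window (?F x) 0 2 \<in> b.Lang" for x
    unfolding b.stable_lang[OF U stU] by simp
  have lhs: "take ?Q (drop (R * ?Q - R) (block (2 * R + 1) f ((subst_word (assoc [] T) ^^ m) (window x (- int R) (2 * R + 2)))))
      = window (?F ((a.S ^^ m) x)) 0 ?Q" if x: "x \<in> a.X" for x
  proof -
    have w: "window x (- int R) (2 * R + 2) \<in> lists A" using a.Lang_lists a.X_window[OF x] by blast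
    have le: "R \<le> R * ?Q" using Q by simp
    have "(subst_word (assoc [] T) ^^ m) (window x (- int R) (2 * R + 2))
        = window ((a.S ^^ m) x) (int L ^ m * - int R) (?Q * (2 * R + 2))"
      unfolding a.table_sw[OF T w] by (rule a.Sn_window[symmetric]) (rule a.X_A[OF x])
    moreover have "R * ?Q - R + ?Q \<le> ?Q * (2 * R + 2) - 2 * R"
      using le by (simp add: algebra_simps)
    moreover have "int L ^ m * - int R + int R + int (R * ?Q - R) = 0"
      using le by (simp add: of_nat_diff)
    ultimately show ?thesis by (simp only: block_window_map take_drop_window)
  qed
  have rhs: "take ?Q (drop K ((subst_word (assoc [] U) ^^ m) (window (?F x) 0 2)))
      = window ((b.S ^^ m) (?F x)) (int K) ?Q" if x: "x \<in> a.X" and r1: ?r1 for x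
  proof -
    have FB: "?F x i \<in> B" for i
    proof -
      have "window (?F (shift i x)) 0 2 \<in> lists B" using r1 b.Lang_lists a.X_shift[OF x] by blast
      then show ?thesis by (simp add: block_map_shift window_def shift_apply upt_rec)
    qed
    then have w: "window (?F x) 0 2 \<in> lists B" by (auto simp: window_def)
    have "(subst_word (assoc [] U) ^^ m) (window (?F x) 0 2) = window ((b.S ^^ m) (?F x)) (int L ^ m * 0) (?Q * 2)"
      unfolding b.table_sw[OF U w] by (rule b.Sn_window[symmetric]) (rule FB)
    \<comment> \<open>As \<open>K < L ^ m\<close>, a stretch of \<open>L ^ m\<close> letters from
      \<open>K\<close> on stays inside the image of two letters; this is why two letters of the
      block image are read.\<close>
    then show ?thesis using K by (simp add: take_drop_window)
  qed
  show ?thesis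
    unfolding renormalizable_def a.stable_ball[OF T stT, where i = "- int R"] blk in_lang
    using lhs rhs by (metis (no_types, lifting))
qed

text \<open>Iterating \<open>F \<circ> \<alpha> ^ m = \<sigma> ^ K \<circ> \<beta> ^ m \<circ> F\<close> places every window of \<open>F x\<close> inside some
  \<open>\<beta> ^ (m * t) (v)\<close> with \<open>v\<close> a two-letter word of \<open>F y\<close>; this reduces \<open>F x \<in> X\<^sub>\<beta>\<close> to a finite check.\<close>

lemma block_conj_of_renormalizable:
  fixes R f defines "F \<equiv> block_map R f"
  assumes m: "m \<ge> 1"
    and C1: "\<And>x. x \<in> a.X \<Longrightarrow> window (F x) 0 2 \<in> b.Lang"
    and C2: "\<And>x. x \<in> a.X \<Longrightarrow> window (F ((a.S ^^ m) x)) 0 (L ^ m) = window ((b.S ^^ m) (F x)) (int K) (L ^ m)"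
    and C3: "\<And>x y. x \<in> a.X \<Longrightarrow> y \<in> a.X \<Longrightarrow> agree R (F x) (F y) \<Longrightarrow> x 0 = y 0"
  shows "block_conj R F"
proof -
  have Fshift: "F (shift k x) = shift k (F x)" for k x unfolding F_def by (rule block_map_shift)
  have Flocal: "F x 0 = F y 0" if "agree R x y" for x y
    using that unfolding F_def block_map_def agree_iff_window by simp
  have C1': "window (F x) i 2 \<in> b.Lang" if "x \<in> a.X" for x i
    using C1[OF a.X_shift[OF that, of i]] by (simp add: Fshift window_shift)
  have FB: "F x i \<in> B" if "x \<in> a.X" for x i
    using b.Lang_lists[OF C1'[OF that, of i]] by (simp add: window_def upt_rec)
  have eq: "F ((a.S ^^ m) x) = shift (int K) ((b.S ^^ m) (F x))" if x: "x \<in> a.X" for x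
  proof
    fix i
    let ?Q = "int L ^ m"
    \<comment> \<open>The hypothesis \<open>C2\<close> concerns a single block; applied to
      \<open>shift q x\<close> it yields block number \<open>q\<close>.\<close>
    define q j where "q = i div ?Q" and "j = nat (i mod ?Q)"
    have "?Q > 0" using a.L by simp
    then have j: "j < L ^ m" "i = ?Q * q + int j" by (auto simp: j_def q_def nat_less_iff)
    have "F ((a.S ^^ m) (shift q x)) (int j) = (b.S ^^ m) (F (shift q x)) (int K + int j)"
      using C2[OF a.X_shift[OF x, of q]] j(1) by (simp add: window_eq_iff)
    then show "F ((a.S ^^ m) x) i = shift (int K) ((b.S ^^ m) (F x)) i"
      by (simp add: Fshift a.Sn_shift b.Sn_shift shift_apply j(2) algebra_simps)
  qed
  have eqs: "\<exists>K. \<forall>x\<in>a.X. F ((a.S ^^ (m * t)) x) = shift K ((b.S ^^ (m * t)) (F x))" for t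
  proof (induction t)
    case 0
    show ?case by (auto intro!: exI[of _ 0])
  next
    case (Suc t)
    then obtain K' where K': "\<And>x. x \<in> a.X \<Longrightarrow> F ((a.S ^^ (m * t)) x) = shift K' ((b.S ^^ (m * t)) (F x))"
      by blast
    have "F ((a.S ^^ (m * Suc t)) x) = shift (int K + int L ^ m * K') ((b.S ^^ (m * Suc t)) (F x))"
      if x: "x \<in> a.X" for x
    proof -
      have "F ((a.S ^^ m) ((a.S ^^ (m * t)) x)) = shift (int K) ((b.S ^^ m) (shift K' ((b.S ^^ (m * t)) (F x))))"
        by (simp add: eq[OF a.X_Sn[OF x]] K'[OF x])
      then show ?thesis by (simp add: funpow_add b.Sn_shift)
    qed
    then show ?case by blast
  qed
  have FX: "F x \<in> b.X" if x: "x \<in> a.X" for x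
  proof (rule b.X_I)
    fix i n
    let ?Q = "L ^ (m * n)" and ?k = "m * n"
    \<comment> \<open>At depth \<open>m * n\<close> the blocks are longer than \<open>n\<close>, so
      a window of length \<open>n\<close> meets at most two of them.\<close>
    have "?k < ?Q" using a.L by (intro power_gt_expt) simp
    then have "n < ?Q" using mult_le_mono1[OF m, of n] by linarith
    obtain p y where y: "y \<in> a.X" and xy: "x = shift p ((a.S ^^ ?k) y)"
      using a.desubstitution[OF x, of ?k] by metis
    obtain K' where K': "F ((a.S ^^ ?k) y) = shift K' ((b.S ^^ ?k) (F y))" using eqs[of n] y by blast
    define c where "c = i + p + K'"
    define q where "q = c div int ?Q"
    have Q: "int ?Q > 0" using a.L by simp
    have c1: "int ?Q * q \<le> c" "c < int ?Q * q + int ?Q"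
      using Q mult_div_mod_eq[of "int ?Q" c] pos_mod_bound[OF Q, of c] pos_mod_sign[OF Q, of c]
      unfolding q_def by linarith+
    have "window (F x) i n = window ((b.S ^^ ?k) (F y)) c n"
      by (simp add: xy Fshift K' window_shift c_def algebra_simps)
    also have "sublist \<dots> (window ((b.S ^^ ?k) (F y)) (int L ^ ?k * q) (?Q * 2))"
    proof (rule sublist_window)
      have "int n < int ?Q" using \<open>n < ?Q\<close> by (simp only: of_nat_less_iff)
      then have "c + int n \<le> int ?Q * q + int ?Q * 2" using c1 by linarith
      then show "c + int n \<le> int L ^ ?k * q + int (?Q * 2)" by simp
    qed (use c1 in simp)
    also have "\<dots> = b.sw ?k (window (F y) q 2)" by (rule b.Sn_window) (rule FB[OF y])
    finally show "window (F x) i n \<in> b.Lang"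
      using b.Lang_sublist b.sw_in_Lang[OF C1'[OF y]] by blast
  qed (rule FB[OF x])
  have "inj_on F a.X"
  proof (rule inj_onI)
    fix x y assume x: "x \<in> a.X" and y: "y \<in> a.X" and "F x = F y"
    then have "shift i x 0 = shift i y 0" for i
      by (intro C3 a.X_shift) (simp_all add: Fshift agree_def)
    then show "x = y" by (auto simp: shift_apply)
  qed
  moreover have "F ` a.X = b.X"
  proof
    show "b.X \<subseteq> F ` a.X"
    proof
      fix y assume y: "y \<in> b.X"
      \<comment> \<open>Surjectivity from minimality: the orbit of \<open>F x0\<close> approximates
        \<open>y\<close>, and an accumulation point of the corresponding shifts of \<open>x0\<close>
        is mapped to \<open>y\<close>.\<close>
      obtain x0 where x0: "x0 \<in> a.X" using a.X_nonempty by blast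
      have "\<exists>q. agree n (shift q (F x0)) y" for n using b.orbit_dense[OF FX[OF x0] y] by blast
      then obtain q where q: "\<And>n. agree n (shift (q n) (F x0)) y" by metis
      obtain x where x: "x \<in> a.X" "cluster (\<lambda>n. shift (q n) x0) x"
        by (rule a.X_cluster_exists[of "\<lambda>n. shift (q n) x0"]) (auto simp: a.X_shift x0)
      have "F x = y"
      proof
        fix i
        obtain l where l: "l \<ge> nat \<bar>i\<bar>" "agree (nat \<bar>i\<bar> + R) (shift (q l) x0) x"
          using x(2) unfolding cluster_def by blast
        have "agree R (shift i (shift (q l) x0)) (shift i x)" by (rule agree_shift[OF l(2)]) simp
        from Flocal[OF this] have "F (shift (q l) x0) i = F x i"
          by (simp add: Fshift shift_apply add.commute)
        moreover have "F (shift (q l) x0) i = y i"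
          using agreeD[OF q[of l], of i] l(1) by (simp add: Fshift)
        ultimately show "F x i = y i" by simp
      qed
      with x(1) show "y \<in> F ` a.X" by blast
    qed
  qed (use FX in auto)
  ultimately have "bij_betw F a.X b.X" by (simp add: bij_betw_def)
  then show ?thesis unfolding block_conj_def using Fshift Flocal C3 by blast
qed

text \<open>Each \<open>G n\<close> is given on the space by its list of values along
  \<open>W\<close>, an element of \<open>V\<close>. Among \<open>length V + 1\<close> indices two
  lists coincide, and the distance of these indices is \<open>m\<close>.\<close>

lemma renormalizable_of_block_conj:
  assumes conj: "block_conj r H" and M: "a.injectivity_radius M" "b.injectivity_radius M"
    and R: "R = radius M" and W: "set W = {w \<in> a.Lang. length w = 2 * R + 1}"
    and V: "V = List.n_lists (length W) Bs" "set Bs = B"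
  obtains t m K where "t \<in> set V" and "1 \<le> m" and "m \<le> length V" and "K < L ^ m"
    and "block_conj R (block_map R (assoc d (zip W t)))"
    and "\<And>x. x \<in> a.X \<Longrightarrow> block_map R (assoc d (zip W t)) ((a.S ^^ m) x)
      = shift (int K) ((b.S ^^ m) (block_map R (assoc d (zip W t)) x))"
proof -
  obtain G k where G: "\<And>n. block_conj R (G n)" and k: "\<And>n. 0 \<le> k n" "\<And>n. k n < int L"
    and Gk: "\<And>n x. x \<in> a.X \<Longrightarrow> G n (a.S x) = shift (k n) (b.S (G (Suc n) x))"
    using renormalization_sequence[OF conj M] unfolding R radius_def by metis
  have "\<exists>x\<in>a.X. window x (- int R) (2 * R + 1) = w" if "w \<in> set W" for w
    using that unfolding W a.Lang_eq_windows[of "2 * R + 1" "- int R"] by blast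
  \<comment> \<open>\<open>pt w\<close> is a point with \<open>w\<close> in its centre, at which
    every \<open>G n\<close> is evaluated to obtain its entry for \<open>w\<close>.\<close>
  then obtain pt where pt: "\<And>w. w \<in> set W \<Longrightarrow> pt w \<in> a.X"
    "\<And>w. w \<in> set W \<Longrightarrow> window (pt w) (- int R) (2 * R + 1) = w" by metis
  define tab where "tab n = map (\<lambda>w. G n (pt w) 0) W" for n
  have tab: "tab n \<in> set V" for n
    unfolding V(1) set_n_lists V(2) tab_def using b.X_A[OF block_conjD(3)[OF G pt(1)]] by auto
  have Gtab: "block_map R (assoc d (zip W (tab n))) x = G n x" if x: "x \<in> a.X" for n x
  proof
    fix j
    let ?w = "window (shift j x) (- int R) (2 * R + 1)"
    have w: "?w \<in> set W" unfolding W using a.X_window[OF a.X_shift[OF x]] by simp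
    have "zip W (tab n) = map (\<lambda>w. (w, G n (pt w) 0)) W"
      unfolding tab_def by (induction W) simp_all
    then have "block_map R (assoc d (zip W (tab n))) x j = G n (pt ?w) 0"
      using assoc_map[OF w] by (simp add: block_map_def window_shift algebra_simps)
    also have "\<dots> = G n (shift j x) 0"
      using G[of n] pt[OF w] a.X_shift[OF x, of j] unfolding block_conj_def agree_iff_window by blast
    also have "\<dots> = G n x j" by (simp add: block_conjD(2)[OF G x] shift_apply)
    finally show "block_map R (assoc d (zip W (tab n))) x j = G n x j" .
  qed
  have "card (tab ` {0..length V}) \<le> card (set V)" using tab by (intro card_mono) auto
  also have "\<dots> < card {0..length V}" using card_length[of V] by simp
  finally have "\<not> inj_on tab {0..length V}" by (rule pigeonhole)
  then obtain i j where ij: "i < j" "j \<le> length V" "tab i = tab j"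
    by (auto simp: inj_on_def) (metis nat_neq_iff)
  define m where "m = j - i"
  obtain K where K: "K < L ^ m"
    and eq: "\<And>x. x \<in> a.X \<Longrightarrow> G i ((a.S ^^ m) x) = shift (int K) ((b.S ^^ m) (G (i + m) x))"
    using renormalization_iterate[of G k m i] Gk k by blast
  have "G (i + m) x = G i x" if "x \<in> a.X" for x
    using Gtab[OF that, of i] Gtab[OF that, of j] ij by (simp add: m_def)
  then have "\<And>x. x \<in> a.X \<Longrightarrow> block_map R (assoc d (zip W (tab i))) ((a.S ^^ m) x)
      = shift (int K) ((b.S ^^ m) (block_map R (assoc d (zip W (tab i))) x))"
    by (simp add: Gtab a.X_Sn eq)
  moreover have "block_conj R (block_map R (assoc d (zip W (tab i))))"
  proof -
    have "bij_betw (block_map R (assoc d (zip W (tab i)))) a.X b.X \<longleftrightarrow> bij_betw (G i) a.X b.X"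
      by (rule bij_betw_cong) (rule Gtab)
    then show ?thesis using G[of i] unfolding block_conj_def by (simp add: Gtab a.X_shift)
  qed
  ultimately show thesis using that[of "tab i" m K] tab ij K by (simp add: m_def)
qed

end

section \<open>The decision procedure\<close>

definition subst_table :: "nat set \<Rightarrow> (nat \<Rightarrow> nat list) \<Rightarrow> (nat \<times> nat list) list" where
  "subst_table A \<alpha> = map (\<lambda>a. (a, \<alpha> a)) (sorted_list_of_set A)"

text \<open>\<open>L\<close> is not part of the input; it is read off the last entry of the
  table.\<close>

definition table_length :: "(nat \<times> nat list) list \<Rightarrow> nat" where
  "table_length T = fold (\<lambda>p r. length (snd p)) T 0"

text \<open>The certificate sought by the algorithm: \<open>M\<close> is an injectivity radius for
  both substitutions, and depth \<open>N\<close> exhibits all words of the lengths that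
  \<open>conjugacy_test\<close> reads.\<close>

definition suitable :: "(nat \<times> nat list) list \<Rightarrow> (nat \<times> nat list) list \<Rightarrow> nat \<Rightarrow> nat \<Rightarrow> bool" where
  "suitable T U M N \<longleftrightarrow>
     stable T (2 * M + 1) N \<and> separating (map (assoc [] T)) M (lang T (2 * M + 1) N) \<and>
     stable U (2 * M + 1) N \<and> separating (map (assoc [] U)) M (lang U (2 * M + 1) N) \<and>
     stable U 2 N \<and> stable T (2 * radius M + 1) N \<and> stable T (2 * radius M + 2) N \<and>
     stable T (4 * radius M + 1) N"

text \<open>Block maps as lists of values along \<open>lang T (2 * R + 1) N\<close>. Words may be
  repeated there; \<open>assoc\<close> then takes the last value.\<close>

definition block_codes :: "(nat \<times> nat list) list \<Rightarrow> (nat \<times> nat list) list \<Rightarrow> nat \<Rightarrow> nat \<Rightarrow> nat list list" where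
  "block_codes T U R N = List.n_lists (length (lang T (2 * R + 1) N)) (map fst U)"

definition conjugacy_test :: "(nat \<times> nat list) list \<Rightarrow> (nat \<times> nat list) list \<Rightarrow> nat \<Rightarrow> nat \<Rightarrow> bool" where
  "conjugacy_test T U R N \<longleftrightarrow>
     (\<exists>t\<in>set (block_codes T U R N). \<exists>m\<in>set [1..<Suc (length (block_codes T U R N))].
      \<exists>K\<in>set [0..<table_length T ^ m].
        renormalizable T U R N (table_length T ^ m) (assoc 0 (zip (lang T (2 * R + 1) N) t)) m K \<and>
        separating (block (2 * R + 1) (assoc 0 (zip (lang T (2 * R + 1) N) t))) (2 * R)
          (lang T (4 * R + 1) N))"

text \<open>The given input is already the code of the table, so \<open>computable\<close> applies
  to it without conversion.\<close>

lemma code_subst_table: "code (subst_table A \<alpha>) = subst_code A \<alpha>"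
proof -
  have "code w = list_encode w" for w :: "nat list"
    by (simp add: code_list_def code_nat_def map_idI)
  then show ?thesis
    by (simp add: subst_table_def subst_code_def code_list_def[of "map _ _"] code_prod_def code_nat_def comp_def)
qed

context primitive_const
begin

lemma A_nonempty: "A \<noteq> {}"
  using subst by (auto simp: substitution_def)

end

lemma is_table_subst_table:
  assumes "primitive_const L A \<alpha>"
  shows "primitive_const.is_table A \<alpha> (subst_table A \<alpha>)"
proof -
  interpret primitive_const L A \<alpha> by (rule assms)
  show ?thesis
    unfolding is_table_def subst_table_def using finite_A
    by (auto simp: image_image intro!: assoc_map)
qed

lemma table_length_subst_table:
  assumes "primitive_const L A \<alpha>"
  shows "table_length (subst_table A \<alpha>) = L"
proof -
  interpret primitive_const L A \<alpha> by (rule assms)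
  have "table_length (map (\<lambda>a. (a, \<alpha> a)) as) = L" if "set as \<subseteq> A" "as \<noteq> []" for as
    using that by (induction as rule: rev_induct) (auto simp: table_length_def len)
  then show ?thesis
    unfolding subst_table_def using finite_A A_nonempty by simp
qed

lemma suitable_exists:
  assumes "primitive_const L A \<alpha>" and "primitive_const L B \<beta>"
  shows "\<exists>M N. suitable (subst_table A \<alpha>) (subst_table B \<beta>) M N"
proof -
  interpret primitive_const_pair L A \<alpha> B \<beta>
    by (intro primitive_const_pair.intro assms)
  note T = is_table_subst_table[OF assms(1)] and U = is_table_subst_table[OF assms(2)]
  obtain Ma Mb where "a.injectivity_radius Ma" "b.injectivity_radius Mb"
    using a.injectivity_radius_exists b.injectivity_radius_exists by blast
  then have M: "a.injectivity_radius (max Ma Mb)" "b.injectivity_radius (max Ma Mb)"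
    using a.injectivity_radius_mono b.injectivity_radius_mono by force+
  let ?M = "max Ma Mb"
  note st = a.stable_eventually[OF T] b.stable_eventually[OF U]
  have "\<forall>\<^sub>F N in sequentially. suitable (subst_table A \<alpha>) (subst_table B \<beta>) ?M N"
    using st(1)[of "2 * ?M + 1"] st(2)[of "2 * ?M + 1"] st(2)[of 2] st(1)[of "2 * radius ?M + 1"]
      st(1)[of "2 * radius ?M + 2"] st(1)[of "4 * radius ?M + 1"]
  proof eventually_elim
    case (elim N)
    then show ?case
      unfolding suitable_def
      using a.separating_images[OF T elim(1)] b.separating_images[OF U elim(2)] M by blast
  qed
  then show ?thesis by (auto simp: eventually_sequentially)
qed

text \<open>The test is right for every suitable pair, so it is immaterial which one the search
  returns.\<close>

lemma conjugacy_test_correct: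
  assumes "primitive_const L A \<alpha>" and "primitive_const L B \<beta>"
    and suitable: "suitable (subst_table A \<alpha>) (subst_table B \<beta>) M N"
  shows "conjugacy_test (subst_table A \<alpha>) (subst_table B \<beta>) (radius M) N \<longleftrightarrow>
    topologically_conjugate (subst_topology A \<alpha>) left_shift (subst_topology B \<beta>) left_shift"
proof -
  interpret primitive_const_pair L A \<alpha> B \<beta>
    by (intro primitive_const_pair.intro assms)
  define T U where "T = subst_table A \<alpha>" and "U = subst_table B \<beta>"
  have T: "a.is_table T" and U: "b.is_table U"
    unfolding T_def U_def using is_table_subst_table[OF assms(1)] is_table_subst_table[OF assms(2)] by simp_all
  have Len: "table_length T = L" unfolding T_def by (rule table_length_subst_table[OF assms(1)])
  define R where "R = radius M"
  have st: "stable T (2 * M + 1) N" "stable U (2 * M + 1) N" "stable U 2 N"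
    "stable T (2 * R + 1) N" "stable T (2 * R + 2) N" "stable T (4 * R + 1) N"
    and sep: "separating (map (assoc [] T)) M (lang T (2 * M + 1) N)"
      "separating (map (assoc [] U)) M (lang U (2 * M + 1) N)"
    using suitable unfolding suitable_def T_def U_def R_def by blast+
  have M: "a.injectivity_radius M" "b.injectivity_radius M"
    using a.separating_images[OF T st(1)] b.separating_images[OF U st(2)] sep by blast+
  define W where "W = lang T (2 * R + 1) N"
  have W: "set W = {w \<in> a.Lang. length w = 2 * R + 1}"
    unfolding W_def by (rule a.stable_lang[OF T st(4)])
  define V where "V = block_codes T U R N"
  have V: "V = List.n_lists (length W) (map fst U)" by (simp add: V_def W_def block_codes_def)
  have test: "conjugacy_test T U R N \<longleftrightarrow>
     (\<exists>t\<in>set V. \<exists>m\<in>set [1..<Suc (length V)]. \<exists>K\<in>set [0..<L ^ m].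
        renormalizable T U R N (L ^ m) (assoc 0 (zip W t)) m K \<and>
        separating (block (2 * R + 1) (assoc 0 (zip W t))) (2 * R) (lang T (4 * R + 1) N))"
    unfolding conjugacy_test_def Len V_def W_def ..
  have "conjugacy_test T U R N \<longleftrightarrow> (\<exists>F r. block_conj r F)"
  proof
    assume "conjugacy_test T U R N"
    then obtain t m K where m: "1 \<le> m" and K: "K < L ^ m"
      and ren: "renormalizable T U R N (L ^ m) (assoc 0 (zip W t)) m K"
      and inj: "separating (block (2 * R + 1) (assoc 0 (zip W t))) (2 * R) (lang T (4 * R + 1) N)"
      unfolding test by auto
    have "block_conj R (block_map R (assoc 0 (zip W t)))"
      using ren[unfolded renormalizable_iff[OF T U st(5,3) K]] inj[unfolded a.separating_block[OF T st(6)]]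
      by (intro block_conj_of_renormalizable[OF m]) auto
    then show "\<exists>F r. block_conj r F" by blast
  next
    assume "\<exists>F r. block_conj r F"
    then obtain F r where F: "block_conj r F" by blast
    have "set (map fst U) = B" using U by (simp add: b.is_table_def)
    then obtain t m K where t: "t \<in> set V" and m: "1 \<le> m" "m \<le> length V" and K: "K < L ^ m"
      and conj: "block_conj R (block_map R (assoc 0 (zip W t)))"
      and eq: "\<And>x. x \<in> a.X \<Longrightarrow> block_map R (assoc 0 (zip W t)) ((a.S ^^ m) x)
        = shift (int K) ((b.S ^^ m) (block_map R (assoc 0 (zip W t)) x))"
      using renormalizable_of_block_conj[OF F M R_def W V, of 0] by blast
    have "renormalizable T U R N (L ^ m) (assoc 0 (zip W t)) m K"
      unfolding renormalizable_iff[OF T U st(5,3) K]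
      using b.X_window[OF block_conjD(3)[OF conj]] by (simp add: eq window_shift)
    moreover have "separating (block (2 * R + 1) (assoc 0 (zip W t))) (2 * R) (lang T (4 * R + 1) N)"
      unfolding a.separating_block[OF T st(6)] using conj by (simp add: block_conj_def)
    moreover have "m \<in> set [1..<Suc (length V)]" "K \<in> set [0..<L ^ m]" using m K by auto
    ultimately show "conjugacy_test T U R N" unfolding test using t by blast
  qed
  then show ?thesis unfolding conjugate_iff_block_conj T_def U_def R_def .
qed

section \<open>Computability of the tests\<close>

lemma computable_funpow [computable_intros]:
  fixes g :: "'a::coded \<Rightarrow> 'b::coded \<Rightarrow> 'b"
  assumes g: "computable (\<lambda>p. g (fst p) (snd p))" and "computable n" and "computable a"
  shows "computable (\<lambda>x. (g x ^^ n x) (a x))"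
proof -
  have "computable (\<lambda>p. g (fst p) (snd (snd p)))"
    using computable_comp[OF g, of "\<lambda>p. (fst p, snd (snd p))"] by (simp add: computable_intros)
  then have "computable (\<lambda>x. rec_nat (a x) (\<lambda>_. g x) (n x))"
    by (intro computable_rec_nat assms)
  moreover have "rec_nat (a x) (\<lambda>_. g x) k = (g x ^^ k) (a x)" for x k
    by (induction k) simp_all
  ultimately show ?thesis by simp
qed

text \<open>Here and below a function is first treated on the tuple of its arguments and then
  composed. Under \<open>map\<close> or a bounded quantifier the arguments acquire a further
  variable; projections of a tuple pass through this by the rules for \<open>fst\<close> and
  \<open>snd\<close>.\<close>

lemma computable_assoc [computable_intros]:
  assumes "computable ps" and "computable k"
  shows "computable (\<lambda>x. assoc d (ps x) (k x))"
proof -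
  have "computable (\<lambda>p :: ('b \<times> 'c) list \<times> 'b. assoc d (fst p) (snd p))"
    unfolding assoc_def by (intro computable_intros)
  from computable_comp[OF this computable_Pair[OF assms]] show ?thesis by simp
qed

lemma computable_subst_word [computable_intros]:
  assumes "computable T" and "computable w"
  shows "computable (\<lambda>x. subst_word (assoc [] (T x)) (w x))"
proof -
  have "computable (\<lambda>p :: ('b \<times> 'b list) list \<times> 'b list. subst_word (assoc [] (fst p)) (snd p))"
    unfolding subst_word_def by (intro computable_intros)
  from computable_comp[OF this computable_Pair[OF assms]] show ?thesis by simp
qed

lemma computable_factors [computable_intros]:
  assumes "computable n" and "computable w"
  shows "computable (\<lambda>x. factors (n x) (w x))"
proof -
  have "computable (\<lambda>p :: nat \<times> 'b list. factors (fst p) (snd p))"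
    unfolding factors_def by (intro computable_intros)
  from computable_comp[OF this computable_Pair[OF assms]] show ?thesis by simp
qed

lemma computable_lang [computable_intros]:
  assumes "computable T" and "computable n" and "computable N"
  shows "computable (\<lambda>x. lang (T x) (n x) (N x))"
proof -
  have "computable (\<lambda>p :: ('b \<times> 'b list) list \<times> nat \<times> nat. lang (fst p) (fst (snd p)) (snd (snd p)))"
    unfolding lang_def by (intro computable_intros)
  from computable_comp[OF this computable_Pair[OF assms(1) computable_Pair[OF assms(2,3)]]]
  show ?thesis by simp
qed

lemma computable_stable [computable_intros]:
  assumes "computable T" and "computable n" and "computable N"
  shows "computable (\<lambda>x. stable (T x) (n x) (N x))"
proof -
  have "computable (\<lambda>p :: ('b \<times> 'b list) list \<times> nat \<times> nat. stable (fst p) (fst (snd p)) (snd (snd p)))"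
    unfolding stable_def by (intro computable_intros)
  from computable_comp[OF this computable_Pair[OF assms(1) computable_Pair[OF assms(2,3)]]]
  show ?thesis by simp
qed

lemma computable_block [computable_intros]:
  assumes "computable n" and "computable ps" and "computable w"
  shows "computable (\<lambda>x. block (n x) (assoc d (ps x)) (w x))"
proof -
  have "computable (\<lambda>p :: nat \<times> ('b list \<times> 'c) list \<times> 'b list. block (fst p) (assoc d (fst (snd p))) (snd (snd p)))"
    unfolding block_def by (intro computable_intros)
  from computable_comp[OF this computable_Pair[OF assms(1) computable_Pair[OF assms(2,3)]]]
  show ?thesis by simp
qed

lemma computable_separating [computable_intros]:
  assumes g: "computable (\<lambda>p. g (fst p) (snd p))" and c: "computable c" and W: "computable W"
  shows "computable (\<lambda>x. separating (g x) (c x) (W x))"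
proof -
  have g1: "computable (\<lambda>p. g (fst (fst p)) (snd (fst p)))"
    by (rule computable_comp[OF g, of fst]) (intro computable_intros)
  have g2: "computable (\<lambda>p. g (fst (fst p)) (snd p))"
    using computable_comp[OF g, of "\<lambda>p. (fst (fst p), snd p)"] by (simp add: computable_intros)
  show ?thesis
    unfolding separating_def
    by (intro computable_intros g1 g2 W computable_comp[OF c] computable_comp[OF W])
qed

lemma computable_renormalizable [computable_intros]:
  assumes "computable T" and "computable U" and "computable R" and "computable N" and "computable Q"
    and "computable ps" and "computable m" and "computable K"
  shows "computable (\<lambda>x. renormalizable (T x) (U x) (R x) (N x) (Q x) (assoc d (ps x)) (m x) (K x))"
proof -
  have "computable (\<lambda>p :: ('b \<times> 'b list) list \<times> ('c \<times> 'c list) list \<times> nat \<times> nat \<times> nat \<times> ('b list \<times> 'c) list \<times> nat \<times> nat.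
      renormalizable (fst p) (fst (snd p)) (fst (snd (snd p))) (fst (snd (snd (snd p))))
        (fst (snd (snd (snd (snd p))))) (assoc d (fst (snd (snd (snd (snd (snd p)))))))
        (fst (snd (snd (snd (snd (snd (snd p))))))) (snd (snd (snd (snd (snd (snd (snd p))))))))"
    unfolding renormalizable_def by (intro computable_intros)
  from computable_comp[OF this computable_Pair[OF assms(1) computable_Pair[OF assms(2)
      computable_Pair[OF assms(3) computable_Pair[OF assms(4) computable_Pair[OF assms(5)
      computable_Pair[OF assms(6) computable_Pair[OF assms(7,8)]]]]]]]]
  show ?thesis by simp
qed

lemma computable_table_length [computable_intros]:
  assumes "computable T" shows "computable (\<lambda>x. table_length (T x))"
proof -
  have "computable table_length" unfolding table_length_def by (intro computable_intros)
  then show ?thesis using assms by (rule computable_comp)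
qed

lemma computable_block_codes [computable_intros]:
  assumes "computable T" and "computable U" and "computable R" and "computable N"
  shows "computable (\<lambda>x. block_codes (T x) (U x) (R x) (N x))"
proof -
  have "computable (\<lambda>p. block_codes (fst p) (fst (snd p)) (fst (snd (snd p))) (snd (snd (snd p))))"
    unfolding block_codes_def by (intro computable_intros)
  from computable_comp[OF this computable_Pair[OF assms(1) computable_Pair[OF assms(2) computable_Pair[OF assms(3,4)]]]]
  show ?thesis by simp
qed

lemma computable_suitable:
  "computable (\<lambda>x. suitable (fst (fst x)) (snd (fst x)) (fst (prod_decode (snd x))) (snd (prod_decode (snd x))))"
  unfolding suitable_def radius_def by (intro computable_intros)

lemma computable_conjugacy_test:
  "computable (\<lambda>x. conjugacy_test (fst (fst x)) (snd (fst x))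
     (radius (fst (prod_decode (snd x)))) (snd (prod_decode (snd x))))"
  unfolding conjugacy_test_def radius_def by (intro computable_intros)

theorem mainTheorem4:
  "\<exists>p :: recf. \<forall>(L::nat) (A::nat set) (B::nat set) (\<alpha>::nat \<Rightarrow> nat list) (\<beta>::nat \<Rightarrow> nat list).
     1 < L \<longrightarrow>
     substitution A \<alpha> \<longrightarrow> constant_length L A \<alpha> \<longrightarrow> primitive_subst A \<alpha> \<longrightarrow>
     substitution B \<beta> \<longrightarrow> constant_length L B \<beta> \<longrightarrow> primitive_subst B \<beta> \<longrightarrow>
     infinite (subst_space A \<alpha>) \<longrightarrow> infinite (subst_space B \<beta>) \<longrightarrow>
     run p [subst_code A \<alpha>, subst_code B \<beta>] =
       Some (if topologically_conjugate (subst_topology A \<alpha>) left_shift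
                                        (subst_topology B \<beta>) left_shift
             then 1 else 0)"
proof -
  \<comment> \<open>One search variable ranges over all pairs \<open>(M, N)\<close> by way of
    \<open>prod_decode\<close>.\<close>
  define P where "P x \<longleftrightarrow> suitable (fst (fst x)) (snd (fst x)) (fst (prod_decode (snd x))) (snd (prod_decode (snd x)))"
    for x :: "((nat \<times> nat list) list \<times> (nat \<times> nat list) list) \<times> nat"
  define t where "t x \<longleftrightarrow> conjugacy_test (fst (fst x)) (snd (fst x))
     (radius (fst (prod_decode (snd x)))) (snd (prod_decode (snd x)))"
    for x :: "((nat \<times> nat list) list \<times> (nat \<times> nat list) list) \<times> nat"
  have "computable P" "computable t"
    unfolding P_def t_def by (rule computable_suitable computable_conjugacy_test)+
  from search_program[OF this] obtain p where
    p: "\<And>x. \<exists>n. P (x, n) \<Longrightarrow> run p [code x] = Some (code (t (x, LEAST n. P (x, n))))"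
    by blast
  \<comment> \<open>The input consists of two numbers, whereas \<open>p\<close> expects the code of
    a pair.\<close>
  have "run (Comp p [pair_prog]) [subst_code A \<alpha>, subst_code B \<beta>] =
       Some (if topologically_conjugate (subst_topology A \<alpha>) left_shift
                                        (subst_topology B \<beta>) left_shift
             then 1 else 0)"
    if prims: "primitive_const L A \<alpha>" "primitive_const L B \<beta>" for L A B \<alpha> \<beta>
  proof -
    let ?x = "(subst_table A \<alpha>, subst_table B \<beta>)"
    obtain M N where "suitable (subst_table A \<alpha>) (subst_table B \<beta>) M N"
      using suitable_exists[OF prims] by blast
    then have "P (?x, prod_encode (M, N))" by (simp add: P_def)
    then have ex: "\<exists>n. P (?x, n)" ..
    then have "P (?x, LEAST n. P (?x, n))" by (rule LeastI_ex)
    then have "t (?x, LEAST n. P (?x, n)) \<longleftrightarrow>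
        topologically_conjugate (subst_topology A \<alpha>) left_shift (subst_topology B \<beta>) left_shift"
      unfolding P_def t_def fst_conv snd_conv by (rule conjugacy_test_correct[OF prims])
    then show ?thesis
      using p[OF ex] by (simp add: run_Comp1 run_pair_prog code_prod_def code_subst_table code_bool_def)
  qed
  then show ?thesis unfolding primitive_const_def by blast
qed

end
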